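(* Let $C\in\mathbb{C}^{d\times d}$ be positive stable (all eigenvalues have positive real part) and let $\mu>0$ be the smallest real part of all eigenvalues of $C$. Let $M$ be the maximal size of a Jordan block associated to $\mu$, i.e. associated to an eigenvalue with real part $\mu$ (so the maximal defect associated to $\mu$ is $M-1$). Then there exists a constant $\mathscr{C}>0$ such that all solutions of $\frac{d}{dt}x(t)=-Cx(t)$, $x(t)\in\mathbb{C}^d$, $t\ge 0$, satisfy $$|x(t)|_2^2\le \mathscr{C}\,(1+t^{2(M-1)})\,e^{-2\mu t}\,|x(0)|_2^2,\qquad t\ge 0.$$ For any choice of the (generalized) eigenvectors and of the positive weights $\beta_n,\beta_n^m$ in the definition of the Hermitian positive definite matrix $P(0)$ (see context), the constant $\mathscr{C}$ can be chosen as $$\mathscr{C}=\begin{cases}(\lambda_{\min}^{P(0)})^{-1}\lambda_{\max}^{P(0)}, & M=1,\\[1ex] 2(\lambda_{\min}^{P(0)})^{-1}\lambda_{\max}^{P(0)}\,c_M\,\displaystyle\max_{n\in I_\mu}\Big[\sum_{m=1}^{l_n}\frac{\beta_n^m}{\min_{k\in\{1,\ldots,m\}}\beta_n^k}\Big], & M\ge 2,\end{cases}$$ where $\lambda_{\min}^{P(0)}$ and $\lambda_{\max}^{P(0)}$ are the smallest and largest eigenvalues of $P(0)$, and for $M\geq 2$ $$c_M=2^{M-2}\left(\prod_{j=1}^{M-1}(4j^2-1)\right)\left(\prod_{j=2}^{M}\sum_{k=1}^{j}\frac{1}{[(j-k)!]^2}\right).$$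
   Context: $|\cdot|_2$ is the Euclidean norm on $\mathbb{C}^d$, $C^H$ is the Hermitian transpose of $C$, and $v\otimes w:=v\,w^H$ for $v,w\in\mathbb{C}^d$. Let $C^H=V\operatorname{diag}(J_1,\ldots,J_N)V^{-1}$ be a Jordan decomposition of $C^H$, where $J_n$ is a Jordan block of length $l_n$ with eigenvalue $\overline{\lambda_n}$ ($\lambda_n$ is an eigenvalue of $C$). For each $n\in\{1,\ldots,N\}$ let $v_n^{(0)},\ldots,v_n^{(l_n-1)}$ be the corresponding Jordan chain: $C^Hv_n^{(0)}=\overline{\lambda_n}v_n^{(0)}$ with $v_n^{(0)}\neq 0$, and $C^Hv_n^{(k)}=\overline{\lambda_n}v_n^{(k)}+v_n^{(k-1)}$ for $k\in\{1,\ldots,l_n-1\}$; all these vectors together form a basis of $\mathbb{C}^d$. Let $I_\mu:=\{n\in\{1,\ldots,N\}: l_n>1,\ \operatorname{Re}(\lambda_n)=\mu\}$. For $n\notin I_\mu$ define $P_n$ as follows. - If $l_n=1$: $P_n:=v_n^{(0)}\otimes v_n^{(0)}$. - If $l_n>1$ and $\operatorname{Re}(\lambda_n)>\mu$: let $\tau_n:=2(\operatorname{Re}(\lambda_n)-\mu)>0$, let $\kappa_1:=1$ and $\kappa_j:=1+\kappa_{j-1}^2$ for $j\ge 2$, let $b_n^j:=\kappa_j\,\tau_n^{2(1-j)}$ for $j\in\{1,\ldots,l_n\}$, and let $P_n:=\sum_{i=1}^{l_n}b_n^{\,l_n+1-i}\,v_n^{(i-1)}\otimes v_n^{(i-1)}$.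 For arbitrary weights $\beta_n>0$ ($n\notin I_\mu$) and $\beta_n^m>0$ ($n\in I_\mu$, $1\le m\le l_n$) define $$P(0):=\sum_{n\notin I_\mu}\beta_nP_n+\sum_{n\in I_\mu}\sum_{m=1}^{l_n}\beta_n^m\,v_n^{(m-1)}\otimes v_n^{(m-1)}.$$ *)

theory Defs
  imports
    "HOL-Analysis.L2_Norm"
    "Jordan_Normal_Form.Jordan_Normal_Form_Uniqueness"
    "Jordan_Normal_Form.Schur_Decomposition"
    "Jordan_Normal_Form.Spectral_Radius"
begin

definition eucl_norm :: "complex vec \<Rightarrow> real" where
  "eucl_norm v = L2_set (\<lambda>i. cmod (v $ i)) {..<dim_vec v}"

definition outer_prod :: "complex vec \<Rightarrow> complex vec \<Rightarrow> complex mat" where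
  "outer_prod v w = mat (dim_vec v) (dim_vec w) (\<lambda>(i, j). v $ i * conjugate (w $ j))"

text \<open>The type of matrices of arbitrary size is not a monoid under addition, so finite sums of
  d x d matrices are taken entrywise.\<close>

definition sum_mats :: "nat \<Rightarrow> ('i \<Rightarrow> complex mat) \<Rightarrow> 'i set \<Rightarrow> complex mat" where
  "sum_mats d f I = mat d d (\<lambda>ij. \<Sum>n\<in>I. f n $$ ij)"

definition positive_stable :: "complex mat \<Rightarrow> bool" where
  "positive_stable A \<longleftrightarrow> (\<forall>z\<in>spectrum A. Re z > 0)"

definition hermitian_pos_def :: "complex mat \<Rightarrow> bool" where
  "hermitian_pos_def A \<longleftrightarrow> mat_adjoint A = A \<and>
     (\<forall>x\<in>carrier_vec (dim_row A). x \<noteq> 0\<^sub>v (dim_row A) \<longrightarrow> Re ((A *\<^sub>v x) \<bullet>c x) > 0)"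

text \<open>A function valued in complex vectors is differentiated componentwise, one-sidedly at 0.\<close>

definition solves_ode :: "nat \<Rightarrow> complex mat \<Rightarrow> (real \<Rightarrow> complex vec) \<Rightarrow> bool" where
  "solves_ode d C x \<longleftrightarrow> (\<forall>t\<ge>0. x t \<in> carrier_vec d \<and>
     (\<forall>i<d. ((\<lambda>s. x s $ i) has_vector_derivative (- (C *\<^sub>v x t)) $ i) (at t within {0..})))"

text \<open>The smallest and largest real part of the eigenvalues. For a Hermitian matrix these are the
  smallest and largest eigenvalue.\<close>

definition min_Re_ev :: "complex mat \<Rightarrow> real" where
  "min_Re_ev A = Min (Re ` spectrum A)"

definition max_Re_ev :: "complex mat \<Rightarrow> real" where
  "max_Re_ev A = Max (Re ` spectrum A)"

text \<open>The maximal size of a Jordan block of \<open>A\<close> belonging to an eigenvalue with real part \<open>\<mu>\<close>.\<close>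

definition max_block_size :: "complex mat \<Rightarrow> real \<Rightarrow> nat" where
  "max_block_size A \<mu> = Max {l. \<exists>bs z. jordan_nf A bs \<and> (l, z) \<in> set bs \<and> Re z = \<mu>}"

text \<open>\<open>A = V diag(J_0, ..., J_{N-1}) V^{-1}\<close>, with \<open>bs\<close> the list of pairs (size, eigenvalue) of
  the blocks. Thus \<open>jordan_nf A bs\<close> holds iff \<open>jordan_decomp A bs V\<close> for some \<open>V\<close>.\<close>

definition jordan_decomp :: "complex mat \<Rightarrow> (nat \<times> complex) list \<Rightarrow> complex mat \<Rightarrow> bool" where
  "jordan_decomp A bs V \<longleftrightarrow>
     0 \<notin> fst ` set bs \<and> (\<exists>W. similar_mat_wit A (jordan_matrix bs) V W)"

text \<open>Below, \<open>bs\<close> and \<open>V\<close> form a Jordan decomposition of the Hermitian transpose of \<open>C\<close>, with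
  blocks counted from 0. The eigenvalue in block \<open>n\<close> is therefore the conjugate of the eigenvalue
  \<open>ev bs n\<close> of \<open>C\<close>. As \<open>jordan_block\<close> is upper triangular, the columns of \<open>V\<close> belonging to block
  \<open>n\<close> are, from left to right, the Jordan chain of that block, starting with the eigenvector.\<close>

definition len :: "(nat \<times> complex) list \<Rightarrow> nat \<Rightarrow> nat" where
  "len bs n = fst (bs ! n)"

definition ev :: "(nat \<times> complex) list \<Rightarrow> nat \<Rightarrow> complex" where
  "ev bs n = cnj (snd (bs ! n))"

definition chain_vec :: "(nat \<times> complex) list \<Rightarrow> complex mat \<Rightarrow> nat \<Rightarrow> nat \<Rightarrow> complex vec" where
  "chain_vec bs V n k = col V ((\<Sum>i<n. len bs i) + k)"

definition I_mu :: "(nat \<times> complex) list \<Rightarrow> real \<Rightarrow> nat set" where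
  "I_mu bs \<mu> = {n. n < length bs \<and> len bs n > 1 \<and> Re (ev bs n) = \<mu>}"

text \<open>The value at 0 only serves to give the value 1 at 1.\<close>

fun kappa :: "nat \<Rightarrow> real" where
  "kappa 0 = 0"
| "kappa (Suc j) = 1 + (kappa j)\<^sup>2"

definition b_coeff :: "(nat \<times> complex) list \<Rightarrow> real \<Rightarrow> nat \<Rightarrow> nat \<Rightarrow> real" where
  "b_coeff bs \<mu> n j = kappa j * (2 * (Re (ev bs n) - \<mu>)) powi (2 * (1 - int j))"

definition P_block ::
  "nat \<Rightarrow> (nat \<times> complex) list \<Rightarrow> complex mat \<Rightarrow> real \<Rightarrow> nat \<Rightarrow> complex mat" where
  "P_block d bs V \<mu> n =
     (if len bs n = 1 then outer_prod (chain_vec bs V n 0) (chain_vec bs V n 0)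
      else sum_mats d
        (\<lambda>i. complex_of_real (b_coeff bs \<mu> n (len bs n + 1 - i)) \<cdot>\<^sub>m
              outer_prod (chain_vec bs V n (i - 1)) (chain_vec bs V n (i - 1)))
        {1..len bs n})"

text \<open>The weights of the blocks outside \<open>I_mu bs \<mu>\<close> are \<open>\<beta> n\<close>; those of the blocks in
  \<open>I_mu bs \<mu>\<close> are \<open>\<gamma> n m\<close> with \<open>m\<close> from 1 to \<open>len bs n\<close>.\<close>

definition P0 ::
  "nat \<Rightarrow> (nat \<times> complex) list \<Rightarrow> complex mat \<Rightarrow> real \<Rightarrow>
   (nat \<Rightarrow> real) \<Rightarrow> (nat \<Rightarrow> nat \<Rightarrow> real) \<Rightarrow> complex mat" where
  "P0 d bs V \<mu> \<beta> \<gamma> =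
     sum_mats d (\<lambda>n. complex_of_real (\<beta> n) \<cdot>\<^sub>m P_block d bs V \<mu> n) ({..<length bs} - I_mu bs \<mu>)
   + sum_mats d (\<lambda>n. sum_mats d
        (\<lambda>m. complex_of_real (\<gamma> n m) \<cdot>\<^sub>m
              outer_prod (chain_vec bs V n (m - 1)) (chain_vec bs V n (m - 1)))
        {1..len bs n}) (I_mu bs \<mu>)"

definition c_const :: "nat \<Rightarrow> real" where
  "c_const M = 2 ^ (M - 2) * (\<Prod>j=1..M-1. 4 * (real j)\<^sup>2 - 1)
     * (\<Prod>j=2..M. \<Sum>k=1..j. 1 / (fact (j - k))\<^sup>2)"

definition decay_const ::
  "nat \<Rightarrow> (nat \<times> complex) list \<Rightarrow> complex mat \<Rightarrow> real \<Rightarrow> nat \<Rightarrow>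
   (nat \<Rightarrow> real) \<Rightarrow> (nat \<Rightarrow> nat \<Rightarrow> real) \<Rightarrow> real" where
  "decay_const d bs V \<mu> M \<beta> \<gamma> =
     (let lmin = min_Re_ev (P0 d bs V \<mu> \<beta> \<gamma>); lmax = max_Re_ev (P0 d bs V \<mu> \<beta> \<gamma>) in
      if M = 1 then inverse lmin * lmax
      else 2 * inverse lmin * lmax * c_const M *
        Max ((\<lambda>n. \<Sum>m=1..len bs n. \<gamma> n m / Min (\<gamma> n ` {1..m})) ` I_mu bs \<mu>))"

definition decay_bound :: "nat \<Rightarrow> complex mat \<Rightarrow> real \<Rightarrow> nat \<Rightarrow> real \<Rightarrow> bool" where
  "decay_bound d C \<mu> M K \<longleftrightarrow> (\<forall>x. solves_ode d C x \<longrightarrow>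
     (\<forall>t\<ge>0. (eucl_norm (x t))\<^sup>2
        \<le> K * (1 + t ^ (2 * (M - 1))) * exp (- 2 * \<mu> * t) * (eucl_norm (x 0))\<^sup>2))"

end

theory Submission
  imports Defs
begin

text \<open>Along a solution \<open>x\<close>, the coordinates \<open>y k = x \<bullet>c v k\<close> with respect to a Jordan chain \<open>v\<close> of the
  adjoint of \<open>C\<close>, with eigenvalue \<open>cnj z\<close>, satisfy \<open>y k' = - z * y k - y (k - 1)\<close>, and the quadratic form of
  \<open>P0\<close> is a weighted sum of the squares of their absolute values. On a chain with \<open>Re z > \<mu>\<close> the recursion defining
  \<open>kappa\<close> makes the weighted sum times \<open>exp (2 * \<mu> * t)\<close> nonincreasing; on a chain with \<open>Re z = \<mu>\<close> the system is solved
  explicitly and estimated by the Cauchy-Schwarz inequality. The Rayleigh bounds for \<open>P0\<close> then transfer the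
  estimate to the Euclidean norm.\<close>

section \<open>Scalar estimates along a Jordan chain\<close>

text \<open>The obstacle is a block of length greater than 1 with real part exactly \<mu>.
  Differentiating a weighted sum of squares along any chain produces mixed products of neighbouring
  coordinates, and only the surplus \<open>2 * (Re z - \<mu>)\<close> of damping can absorb them. At
  real part \<mu> this surplus is 0, and the coordinates really do carry polynomial factors, so such
  blocks are compared directly with their initial values. That comparison explains the constants.
  Coordinate \<open>k\<close> depends on the initial coordinates 0 to \<open>k\<close> only, so
  trading the weighted initial sum for the unweighted one costs just the minimum of the first
  \<open>k + 1\<close> weights. Squaring and summing the coefficients \<open>t ^ j / fact j\<close>
  leaves the sum of \<open>1 / (fact i)\<^sup>2\<close> over \<open>i < M\<close>, which is the
  factor \<open>j = M\<close> of the last product in \<open>c_const M\<close>; the remaining factors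
  are at least 1. Since the resulting factor is at least 1, the blocks that decay without polynomial
  growth obey the same bound, and the blocks can be added up.\<close>

lemma decreasing_halfline:
  fixes f f' :: "real \<Rightarrow> real"
  assumes deriv: "\<And>t. t \<ge> 0 \<Longrightarrow> (f has_real_derivative f' t) (at t within {0..})"
    and nonpos: "\<And>t. t \<ge> 0 \<Longrightarrow> f' t \<le> 0" and "t \<ge> 0"
  shows "f t \<le> f 0"
proof (cases "t = 0")
  case False
  then have "0 < t" using \<open>t \<ge> 0\<close> by simp
  \<comment> \<open>Inside the open interval the one-sided derivative is an ordinary one; the
    endpoint 0, where only a one-sided derivative exists, enters through continuity alone.\<close>
  show ?thesis
  proof (rule DERIV_nonpos_imp_decreasing_open[of 0 t f])
    show "0 \<le> t" by fact
    show "\<exists>y. (f has_real_derivative y) (at x) \<and> y \<le> 0" if "0 < x" "x < t" for x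
    proof -
      have "(f has_real_derivative f' x) (at x within {0<..})"
        using that by (intro has_field_derivative_subset[OF deriv]) auto
      moreover have "at x within {0<..} = at x"
        using that by (intro at_within_open) auto
      ultimately show ?thesis using nonpos[of x] that by auto
    qed
    show "continuous_on {0..t} f"
    proof (rule continuous_on_subset)
      show "continuous_on {0..} f"
        using deriv by (auto simp: continuous_on_eq_continuous_within intro: DERIV_continuous)
    qed auto
  qed
qed simp

text \<open>Every real linear functional of \<open>f\<close> has derivative 0 and so cannot
  increase. Using \<open>Re\<close>, \<open>Im\<close> and their negatives turns the inequalities
  into equality.\<close>

lemma constant_halfline:
  fixes f :: "real \<Rightarrow> complex"
  assumes "\<And>t. t \<ge> 0 \<Longrightarrow> (f has_vector_derivative 0) (at t within {0..})" and "t \<ge> 0"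
  shows "f t = f 0"
proof -
  have *: "((\<lambda>t. h (f t)) has_real_derivative 0) (at t within {0..})"
    if "bounded_linear h" "t \<ge> 0" for h :: "complex \<Rightarrow> real" and t
    using bounded_linear.has_vector_derivative[OF that(1) assms(1)[OF that(2)]]
    by (simp add: has_real_derivative_iff_has_vector_derivative linear_0 bounded_linear.linear that)
  have "h (f t) \<le> h (f 0)" if "bounded_linear h" for h :: "complex \<Rightarrow> real"
    using decreasing_halfline[where f = "\<lambda>t. h (f t)" and f' = "\<lambda>_. 0"] * that assms(2) by auto
  from this[OF bounded_linear_Re] this[OF bounded_linear_Im]
    this[OF bounded_linear_minus[OF bounded_linear_Re]]
    this[OF bounded_linear_minus[OF bounded_linear_Im]]
  show ?thesis by (simp add: complex_eq_iff)
qed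

lemma has_vector_derivative_integrating_factor:
  fixes f :: "real \<Rightarrow> complex"
  assumes "(f has_vector_derivative - z * f t - g) (at t within S)"
  shows "((\<lambda>t. exp (z * of_real t) * f t) has_vector_derivative - exp (z * of_real t) * g)
    (at t within S)"
proof -
  have "((\<lambda>t. exp (z * of_real t)) has_vector_derivative z * exp (z * of_real t)) (at t within S)"
    by (rule has_vector_derivative_real_field) (auto intro!: derivative_eq_intros)
  from has_vector_derivative_mult[OF this assms] show ?thesis
    by (simp add: algebra_simps)
qed

text \<open>Once the factor \<open>exp (z * t)\<close> is split off, a chain obeys
  \<open>u k' = - u (k - 1)\<close>; these monomials are its fundamental solutions.\<close>

lemma has_real_derivative_power_fact:
  "((\<lambda>t::real. (- t) ^ Suc m / fact (Suc m)) has_real_derivative - ((- t) ^ m / fact m)) (at t within S)"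
proof -
  have "((\<lambda>t::real. (- t) ^ Suc m) has_real_derivative - (1 + real m) * (- t) ^ m) (at t within S)"
    by (rule DERIV_cong[OF DERIV_power_Suc[OF DERIV_minus[OF DERIV_ident]]]) (simp add: algebra_simps)
  moreover have "- c * x / (c * y) = - (x / y)" if "c > 0" for c x y :: real
    using that by simp
  from this[of "1 + real m" "(- t) ^ m" "fact m"]
  have "- (1 + real m) * (- t) ^ m / fact (Suc m) = - ((- t) ^ m / fact m)" by simp
  ultimately show ?thesis by (rule DERIV_cong[OF DERIV_cdivide])
qed

text \<open>With \<open>u k = exp (z * t) * y k\<close> the system is \<open>u' = - N u\<close> for
  the nilpotent shift \<open>N\<close>, and the right-hand side is the finite exponential series of
  \<open>- t * N\<close> applied to the initial values.\<close>

lemma jordan_chain_solution: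
  fixes y :: "nat \<Rightarrow> real \<Rightarrow> complex"
  assumes deriv: "\<And>k t. k < l \<Longrightarrow> t \<ge> 0 \<Longrightarrow> (y k has_vector_derivative
      - z * y k t - (if k = 0 then 0 else y (k - 1) t)) (at t within {0..})"
    and "k < l" "t \<ge> 0"
  shows "exp (z * of_real t) * y k t = (\<Sum>i\<le>k. of_real ((- t) ^ (k - i) / fact (k - i)) * y i 0)"
  using assms(2,3)
proof (induction k arbitrary: t)
  case 0
  define u where "u = (\<lambda>t. exp (z * complex_of_real t) * y 0 t)"
  have "(u has_vector_derivative 0) (at t within {0..})" if "t \<ge> 0" for t
    using has_vector_derivative_integrating_factor[OF deriv[OF 0(1) that]] by (simp add: u_def)
  from constant_halfline[OF this 0(2)] show ?case by (simp add: u_def)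
next
  case (Suc k)
  \<comment> \<open>The subtracted sum omits the constant summand \<open>i = Suc k\<close>. All its
    powers have positive exponent and vanish at 0, so \<open>u 0\<close> is exactly that missing
    summand.\<close>
  define u where "u = (\<lambda>t. exp (z * complex_of_real t) * y (Suc k) t -
    (\<Sum>i\<le>k. of_real ((- t) ^ Suc (k - i) / fact (Suc (k - i))) * y i 0))"
  have "(u has_vector_derivative 0) (at t within {0..})" if "t \<ge> 0" for t
  proof -
    have "((\<lambda>t. \<Sum>i\<le>k. of_real ((- t) ^ Suc (k - i) / fact (Suc (k - i))) * y i 0) has_vector_derivative
        (\<Sum>i\<le>k. of_real (- ((- t) ^ (k - i) / fact (k - i))) * y i 0)) (at t within {0..})"
      by (intro has_vector_derivative_sum has_vector_derivative_mult_left
          has_vector_derivative_of_real has_real_derivative_power_fact)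
    moreover have "((\<lambda>t. exp (z * complex_of_real t) * y (Suc k) t) has_vector_derivative
        - exp (z * of_real t) * y k t) (at t within {0..})"
      using has_vector_derivative_integrating_factor[OF deriv[OF Suc(2) that]] by simp
    ultimately have "(u has_vector_derivative - exp (z * of_real t) * y k t -
        (\<Sum>i\<le>k. of_real (- ((- t) ^ (k - i) / fact (k - i))) * y i 0)) (at t within {0..})"
      unfolding u_def by (rule has_vector_derivative_diff[rotated])
    also have "- exp (z * of_real t) * y k t -
        (\<Sum>i\<le>k. of_real (- ((- t) ^ (k - i) / fact (k - i))) * y i 0) = 0"
      using Suc(1)[OF _ that] Suc(2) by (simp add: sum_negf)
    finally show ?thesis .
  qed
  from constant_halfline[OF this Suc(3)]
  have "u t = u 0" .
  then show ?case by (simp add: u_def Suc_diff_le algebra_simps)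
qed

lemma Cauchy_Schwarz_sum_cmod:
  fixes a :: "nat \<Rightarrow> real" and c :: "nat \<Rightarrow> complex"
  assumes "\<And>i. i \<in> A \<Longrightarrow> a i \<ge> 0"
  shows "(cmod (\<Sum>i\<in>A. of_real (a i) * c i))\<^sup>2 \<le> (\<Sum>i\<in>A. (a i)\<^sup>2) * (\<Sum>i\<in>A. (cmod (c i))\<^sup>2)"
proof -
  have "cmod (\<Sum>i\<in>A. of_real (a i) * c i) \<le> (\<Sum>i\<in>A. a i * cmod (c i))"
    using assms by (intro sum_norm_le) (simp add: norm_mult)
  also have "\<dots> \<le> L2_set a A * L2_set (\<lambda>i. cmod (c i)) A"
    using L2_set_mult_ineq[of a "\<lambda>i. cmod (c i)" A] assms by simp
  finally have "(cmod (\<Sum>i\<in>A. of_real (a i) * c i))\<^sup>2 \<le> (L2_set a A * L2_set (\<lambda>i. cmod (c i)) A)\<^sup>2"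
    by (rule power_mono) simp
  then show ?thesis by (simp add: power_mult_distrib L2_set_def sum_nonneg)
qed

text \<open>An even power \<open>t ^ (2 * i)\<close> with \<open>i < M\<close> is at most 1 for
  \<open>t\<close> up to 1 and at most the highest power beyond; adding the two cases gives the
  factor \<open>1 + t ^ (2 * (M - 1))\<close>.\<close>

lemma sum_power_fact_bound:
  fixes t :: real
  assumes "k < M" "t \<ge> 0"
  shows "(\<Sum>i\<le>k. (t ^ (k - i) / fact (k - i))\<^sup>2) \<le> (\<Sum>i<M. 1 / (fact i)\<^sup>2) * (1 + t ^ (2 * (M - 1)))"
proof -
  have *: "t ^ (2 * i) \<le> 1 + t ^ (2 * (M - 1))" if "i < M" for i
  proof (cases "t \<le> 1")
    case True
    then show ?thesis using assms by (intro order_trans[OF power_le_one]) auto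
  next
    case False
    then have "t ^ (2 * i) \<le> t ^ (2 * (M - 1))" using that by (intro power_increasing) auto
    then show ?thesis by simp
  qed
  have "(\<Sum>i\<le>k. (t ^ (k - i) / fact (k - i))\<^sup>2) = (\<Sum>i\<le>k. (t ^ i / fact i)\<^sup>2)"
    by (rule sum.reindex_bij_witness[where i = "\<lambda>i. k - i" and j = "\<lambda>i. k - i"]) auto
  also have "\<dots> \<le> (\<Sum>i<M. (t ^ i / fact i)\<^sup>2)"
    using assms by (intro sum_mono2) auto
  also have "\<dots> \<le> (\<Sum>i<M. 1 / (fact i)\<^sup>2 * (1 + t ^ (2 * (M - 1))))"
  proof (rule sum_mono)
    fix i assume "i \<in> {..<M}"
    then have "1 / (fact i)\<^sup>2 * t ^ (2 * i) \<le> 1 / (fact i)\<^sup>2 * (1 + t ^ (2 * (M - 1)))"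
      using *[of i] by (intro mult_left_mono) auto
    then show "(t ^ i / fact i)\<^sup>2 \<le> 1 / (fact i)\<^sup>2 * (1 + t ^ (2 * (M - 1)))"
      by (simp only: power_divide power_even_eq mult_1 times_divide_eq_left)
  qed
  finally show ?thesis by (simp add: sum_distrib_right)
qed

text \<open>Each coordinate is bounded separately by Cauchy-Schwarz in the explicit solution.
  Coordinate \<open>m - 1\<close> involves only the initial values carrying the weights
  \<open>g 1\<close> to \<open>g m\<close>, hence the running minimum in the constant.\<close>

lemma jordan_chain_critical_bound:
  fixes y :: "nat \<Rightarrow> real \<Rightarrow> complex" and g :: "nat \<Rightarrow> real"
  assumes deriv: "\<And>k t. k < l \<Longrightarrow> t \<ge> 0 \<Longrightarrow> (y k has_vector_derivative
      - z * y k t - (if k = 0 then 0 else y (k - 1) t)) (at t within {0..})"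
    and g: "\<And>m. 1 \<le> m \<Longrightarrow> m \<le> l \<Longrightarrow> g m > 0" and "l \<le> M" "t \<ge> 0"
  shows "(\<Sum>m=1..l. g m * (cmod (y (m - 1) t))\<^sup>2) \<le>
    (\<Sum>m=1..l. g m / Min (g ` {1..m})) * (\<Sum>i<M. 1 / (fact i)\<^sup>2) * (1 + t ^ (2 * (M - 1))) *
    exp (- 2 * Re z * t) * (\<Sum>m=1..l. g m * (cmod (y (m - 1) 0))\<^sup>2)"
proof -
  define S where "S = (\<Sum>i<M. 1 / (fact i)\<^sup>2) * (1 + t ^ (2 * (M - 1)))"
  define Q where "Q = (\<Sum>m=1..l. g m * (cmod (y (m - 1) 0))\<^sup>2)"
  have "S \<ge> 0" using \<open>t \<ge> 0\<close> by (auto simp: S_def intro!: mult_nonneg_nonneg sum_nonneg)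
  have main: "(cmod (y (m - 1) t))\<^sup>2 \<le> exp (- 2 * Re z * t) * (S * (Q / Min (g ` {1..m})))"
    if m: "1 \<le> m" "m \<le> l" for m
  proof -
    define k where "k = m - 1"
    have k: "k < l" "k < M" using m \<open>l \<le> M\<close> by (auto simp: k_def)
    \<comment> \<open>This abbreviates the running minimum of the weights, not a decay rate.\<close>
    let ?\<mu> = "Min (g ` {1..m})"
    have "?\<mu> \<in> g ` {1..m}" using m by (intro Min_in) auto
    then have pos: "?\<mu> > 0" using g m by auto
    have "(\<Sum>i\<le>k. ?\<mu> * (cmod (y i 0))\<^sup>2) \<le> (\<Sum>i\<le>k. g (Suc i) * (cmod (y i 0))\<^sup>2)"
      using m by (intro sum_mono mult_right_mono Min_le) (auto simp: k_def)
    also have "\<dots> = (\<Sum>j=1..m. g j * (cmod (y (j - 1) 0))\<^sup>2)"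
      using m by (intro sum.reindex_bij_witness[where i = "\<lambda>i. i - 1" and j = Suc]) (auto simp: k_def)
    also have "\<dots> \<le> Q"
      unfolding Q_def using m g by (intro sum_mono2) (auto intro!: mult_nonneg_nonneg intro: less_imp_le)
    finally have *: "(\<Sum>i\<le>k. (cmod (y i 0))\<^sup>2) \<le> Q / ?\<mu>"
      using pos by (simp add: sum_distrib_left[symmetric] field_simps)
    \<comment> \<open>The signs of \<open>(- t) ^ (k - i)\<close> are moved to the initial values,
      because the Cauchy-Schwarz lemma asks for nonnegative real coefficients.\<close>
    have "(cmod (exp (z * of_real t) * y k t))\<^sup>2 =
        (cmod (\<Sum>i\<le>k. of_real (t ^ (k - i) / fact (k - i)) * ((- 1) ^ (k - i) * y i 0)))\<^sup>2"
      by (subst jordan_chain_solution[of l, OF deriv k(1) \<open>t \<ge> 0\<close>])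
        (auto intro!: arg_cong[where f = "\<lambda>x. (cmod x)\<^sup>2"] sum.cong simp: power_minus[of "complex_of_real t"] mult_ac)
    also have "\<dots> \<le> (\<Sum>i\<le>k. (t ^ (k - i) / fact (k - i))\<^sup>2) * (\<Sum>i\<le>k. (cmod ((- 1) ^ (k - i) * y i 0))\<^sup>2)"
      using \<open>t \<ge> 0\<close> by (intro Cauchy_Schwarz_sum_cmod) auto
    also have "\<dots> \<le> S * (Q / ?\<mu>)"
      using sum_power_fact_bound[OF k(2) \<open>t \<ge> 0\<close>] * \<open>S \<ge> 0\<close>
      by (intro mult_mono) (auto simp: S_def norm_mult norm_power intro!: sum_nonneg)
    finally have "exp (2 * Re z * t) * (cmod (y k t))\<^sup>2 \<le> S * (Q / ?\<mu>)"
      by (simp add: norm_mult power_mult_distrib exp_double[symmetric] mult.assoc)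
    then have "exp (- 2 * Re z * t) * (exp (2 * Re z * t) * (cmod (y k t))\<^sup>2) \<le>
        exp (- 2 * Re z * t) * (S * (Q / ?\<mu>))"
      by (intro mult_left_mono) auto
    then show ?thesis by (simp add: k_def mult.assoc[symmetric] exp_add[symmetric])
  qed
  have "(\<Sum>m=1..l. g m * (cmod (y (m - 1) t))\<^sup>2) \<le>
      (\<Sum>m=1..l. g m * (exp (- 2 * Re z * t) * (S * (Q / Min (g ` {1..m})))))"
    using main g by (intro sum_mono mult_left_mono) (auto intro: less_imp_le)
  also have "\<dots> = (\<Sum>m=1..l. g m / Min (g ` {1..m})) * S * exp (- 2 * Re z * t) * Q"
    unfolding sum_distrib_right by (rule sum.cong) (simp_all add: mult_ac)
  finally show ?thesis by (simp only: S_def Q_def mult.assoc)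
qed

section \<open>Chains with damping stronger than \<mu>\<close>

lemma kappa_pos: "j \<ge> 1 \<Longrightarrow> kappa j > 0"
  by (cases j) (auto intro: add_pos_nonneg)

text \<open>The spare term \<open>(u l)\<^sup>2\<close> on the left drives the induction. The new
  mixed term is at most \<open>(u l)\<^sup>2 + (kappa l * u (Suc l))\<^sup>2\<close>; the first part
  is covered by the spare term, and the second together with a fresh spare term costs
  \<open>1 + (kappa l)\<^sup>2\<close> times \<open>(u (Suc l))\<^sup>2\<close>. This is where the
  recursion for \<open>kappa\<close> comes from.\<close>

lemma kappa_quadratic_form_nonneg:
  fixes u :: "nat \<Rightarrow> real"
  assumes "l \<ge> 1"
  shows "2 * (\<Sum>j=1..<l. kappa j * u j * u (Suc j)) + (u l)\<^sup>2 \<le> (\<Sum>j=1..l. kappa j * (u j)\<^sup>2)"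
  using assms
proof (induction l rule: dec_induct)
  case (step l)
  have "2 * (kappa l * u l * u (Suc l)) \<le> (u l)\<^sup>2 + (kappa l * u (Suc l))\<^sup>2"
    using sum_squares_ge_zero[of "u l - kappa l * u (Suc l)" 0] by (simp add: power2_eq_square algebra_simps)
  with step show ?case by (simp add: sum.atLeastLessThan_Suc power_mult_distrib algebra_simps)
qed simp

text \<open>Rescaling reduces this to the preceding inequality, in which \<tau> is absent; the
  powers of \<tau> in the weights are the ones that make the rescaling work.\<close>

lemma kappa_weighted_form_nonneg:
  fixes a :: "nat \<Rightarrow> real"
  assumes "\<tau> > 0" and w: "\<And>j. w j = kappa j * \<tau> powi (2 * (1 - int j))"
  shows "2 * (\<Sum>k=1..<l. w (l - k) * a k * a (k - 1)) \<le> \<tau> * (\<Sum>k<l. w (l - k) * (a k)\<^sup>2)"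
proof (cases "l = 0")
  case False
  \<comment> \<open>The order is reversed because the eigenvector, \<open>k = 0\<close>, carries the
    largest index \<open>l\<close> of \<open>kappa\<close>. Neighbours scaled by
    \<open>\<tau> powi (1 - int j)\<close> and \<open>\<tau> powi (- int j)\<close> multiply, with
    one further \<tau>, to the power in \<open>w j\<close>.\<close>
  define u where "u = (\<lambda>j. a (l - j) * \<tau> powi (1 - int j))"
  have diag: "kappa j * (u j)\<^sup>2 = w j * (a (l - j))\<^sup>2" for j
    by (simp add: u_def w power_mult_distrib power_int_mult_distrib power_int_power' mult.commute)
  have off: "\<tau> * (kappa j * u j * u (Suc j)) = w j * a (l - j) * a (l - j - 1)" for j
  proof -
    have "\<tau> * (\<tau> powi (1 - int j) * \<tau> powi (- int j)) = \<tau> powi (1 + ((1 - int j) + - int j))"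
      unfolding power_int_add[OF disjI1[OF less_imp_neq[OF \<open>\<tau> > 0\<close>, symmetric]]] by simp
    also have "1 + ((1 - int j) + - int j) = 2 * (1 - int j)" by simp
    finally show ?thesis by (simp add: u_def w mult_ac)
  qed
  have "2 * (\<Sum>k=1..<l. w (l - k) * a k * a (k - 1)) =
      2 * (\<Sum>j=1..<l. w j * a (l - j) * a (l - j - 1))"
    by (rule arg_cong, rule sum.reindex_bij_witness[where i = "\<lambda>j. l - j" and j = "\<lambda>j. l - j"]) auto
  also have "\<dots> = \<tau> * (2 * (\<Sum>j=1..<l. kappa j * u j * u (Suc j)))"
    by (simp only: off[symmetric] sum_distrib_left[symmetric] mult.left_commute[of 2])
  also have "\<dots> \<le> \<tau> * (\<Sum>j=1..l. kappa j * (u j)\<^sup>2)"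
    using kappa_quadratic_form_nonneg[of l u] False \<open>\<tau> > 0\<close>
    by (intro mult_left_mono) (auto intro: order_trans[rotated])
  also have "(\<Sum>j=1..l. kappa j * (u j)\<^sup>2) = (\<Sum>k<l. w (l - k) * (a k)\<^sup>2)"
    unfolding diag by (rule sum.reindex_bij_witness[where i = "\<lambda>j. l - j" and j = "\<lambda>j. l - j"]) auto
  finally show ?thesis .
qed simp

lemma has_real_derivative_cmod_power2:
  assumes "(f has_vector_derivative f') (at t within S)"
  shows "((\<lambda>t. (cmod (f t))\<^sup>2) has_real_derivative 2 * Re (f' * cnj (f t))) (at t within S)"
proof -
  have *: "((\<lambda>t. Re (f t)) has_real_derivative Re f') (at t within S)"
    "((\<lambda>t. Im (f t)) has_real_derivative Im f') (at t within S)"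
    using bounded_linear.has_vector_derivative[OF bounded_linear_Re assms]
      bounded_linear.has_vector_derivative[OF bounded_linear_Im assms]
    by (simp_all add: has_real_derivative_iff_has_vector_derivative)
  from DERIV_add[OF DERIV_power[OF *(1), of 2] DERIV_power[OF *(2), of 2]] show ?thesis
    by (simp add: cmod_power2 algebra_simps)
qed

text \<open>The derivative of the weighted sum is at most \<open>- 2 * Re z\<close> times the sum
  plus mixed terms of neighbours. \<open>kappa_weighted_form_nonneg\<close> with \<tau> equal to
  \<open>2 * (Re z - \<mu>)\<close> bounds the mixed terms, and the rate \<open>- 2 * \<mu>\<close>
  remains.\<close>

lemma jordan_chain_damped_bound:
  fixes y :: "nat \<Rightarrow> real \<Rightarrow> complex"
  assumes deriv: "\<And>k t. k < l \<Longrightarrow> t \<ge> 0 \<Longrightarrow> (y k has_vector_derivative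
      - z * y k t - (if k = 0 then 0 else y (k - 1) t)) (at t within {0..})"
    and "Re z > \<mu>" and w: "\<And>j. w j = kappa j * (2 * (Re z - \<mu>)) powi (2 * (1 - int j))"
    and "t \<ge> 0"
  shows "(\<Sum>k<l. w (l - k) * (cmod (y k t))\<^sup>2) \<le> exp (- 2 * \<mu> * t) * (\<Sum>k<l. w (l - k) * (cmod (y k 0))\<^sup>2)"
proof -
  define E where "E = (\<lambda>t. exp (2 * \<mu> * t) * (\<Sum>k<l. w (l - k) * (cmod (y k t))\<^sup>2))"
  define D where "D = (\<lambda>k t. - z * y k t - (if k = 0 then 0 else y (k - 1) t))"
  define E' where "E' = (\<lambda>t. exp (2 * \<mu> * t) *
    (2 * \<mu> * (\<Sum>k<l. w (l - k) * (cmod (y k t))\<^sup>2) + (\<Sum>k<l. w (l - k) * (2 * Re (D k t * cnj (y k t))))))"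
  have w_nonneg: "w j \<ge> 0" for j
    using \<open>Re z > \<mu>\<close> kappa_pos[of j] by (cases "j = 0") (auto simp: w)
  have "E t \<le> E 0"
  proof (rule decreasing_halfline)
    fix t :: real assume "t \<ge> 0"
    have "((\<lambda>t. (\<Sum>k<l. w (l - k) * (cmod (y k t))\<^sup>2)) has_real_derivative
        (\<Sum>k<l. w (l - k) * (2 * Re (D k t * cnj (y k t))))) (at t within {0..})"
      using deriv[OF _ \<open>t \<ge> 0\<close>] by (intro DERIV_sum DERIV_cmult has_real_derivative_cmod_power2) (auto simp: D_def)
    moreover have "((\<lambda>t. exp (2 * \<mu> * t)) has_real_derivative exp (2 * \<mu> * t) * (2 * \<mu>)) (at t within {0..})"
      by (auto intro!: derivative_eq_intros)
    ultimately show "(E has_real_derivative E' t) (at t within {0..})"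
      unfolding E_def E'_def by (rule DERIV_cong[OF DERIV_mult[rotated]]) (simp add: algebra_simps)
    have "w (l - k) * (2 * Re (D k t * cnj (y k t))) \<le> - (2 * Re z) * (w (l - k) * (cmod (y k t))\<^sup>2) +
        (if k = 0 then 0 else 2 * (w (l - k) * cmod (y k t) * cmod (y (k - 1) t)))" for k
    proof -
      have "Re (z * y k t * cnj (y k t)) = Re z * (cmod (y k t))\<^sup>2"
        by (simp add: mult.assoc complex_norm_square[symmetric] flip: of_real_power)
      moreover have "- Re (y (k - 1) t * cnj (y k t)) \<le> cmod (y k t) * cmod (y (k - 1) t)"
        using complex_Re_le_cmod[of "- (y (k - 1) t * cnj (y k t))"] by (simp add: norm_mult mult.commute)
      ultimately have "Re (D k t * cnj (y k t)) \<le> - Re z * (cmod (y k t))\<^sup>2 +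
          (if k = 0 then 0 else cmod (y k t) * cmod (y (k - 1) t))"
        by (auto simp: D_def left_diff_distrib simp del: times_complex.sel)
      from mult_left_mono[OF this w_nonneg[of "l - k"]] show ?thesis
        by (auto simp: algebra_simps split: if_splits)
    qed
    then have "(\<Sum>k<l. w (l - k) * (2 * Re (D k t * cnj (y k t)))) \<le>
        (\<Sum>k<l. - (2 * Re z) * (w (l - k) * (cmod (y k t))\<^sup>2) +
        (if k = 0 then 0 else 2 * (w (l - k) * cmod (y k t) * cmod (y (k - 1) t))))"
      by (rule sum_mono)
    also have "\<dots> = - (2 * Re z) * (\<Sum>k<l. w (l - k) * (cmod (y k t))\<^sup>2) +
        2 * (\<Sum>k=1..<l. w (l - k) * cmod (y k t) * cmod (y (k - 1) t))"
      unfolding sum.distrib sum_distrib_left by (intro arg_cong2[where f = "(+)"] refl sum.mono_neutral_cong_right) auto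
    also have "\<dots> \<le> - (2 * Re z) * (\<Sum>k<l. w (l - k) * (cmod (y k t))\<^sup>2) +
        2 * (Re z - \<mu>) * (\<Sum>k<l. w (l - k) * (cmod (y k t))\<^sup>2)"
      using kappa_weighted_form_nonneg[of "2 * (Re z - \<mu>)" w l "\<lambda>k. cmod (y k t)"] \<open>Re z > \<mu>\<close> w by simp
    finally show "E' t \<le> 0"
      unfolding E'_def by (intro mult_nonneg_nonpos) (auto simp: algebra_simps)
  qed fact
  then have "exp (- 2 * \<mu> * t) * E t \<le> exp (- 2 * \<mu> * t) * E 0" by simp
  then show ?thesis by (simp add: E_def mult.assoc[symmetric] exp_add[symmetric])
qed

text \<open>After reversing the index, the sum is the factor \<open>j = M\<close> of the last
  product in \<open>c_const\<close>, and every other factor is at least 1.\<close>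

lemma sum_inverse_fact_squares_le_c_const:
  assumes "M \<ge> 2"
  shows "(\<Sum>i<M. 1 / (fact i)\<^sup>2) \<le> c_const M" and "1 \<le> c_const M"
proof -
  define S :: "nat \<Rightarrow> real" where "S = (\<lambda>j. \<Sum>k=1..j. 1 / (fact (j - k))\<^sup>2)"
  have S_eq: "S j = (\<Sum>i<j. 1 / (fact i)\<^sup>2)" for j
    unfolding S_def by (rule sum.reindex_bij_witness[where i = "\<lambda>i. j - i" and j = "\<lambda>k. j - k"]) auto
  have S_ge_1: "S j \<ge> 1" if "j \<ge> 1" for j
  proof -
    have "(\<Sum>i<1. 1 / (fact i)\<^sup>2) \<le> S j"
      unfolding S_eq using that by (intro sum_mono2) auto
    then show ?thesis by simp
  qed
  have p: "(\<Prod>j=1..M-1. 4 * (real j)\<^sup>2 - 1) \<ge> 1"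
  proof (rule prod_ge_1)
    fix j assume "j \<in> {1..M-1}"
    then have "(real j)\<^sup>2 \<ge> 1" by simp
    then show "1 \<le> 4 * (real j)\<^sup>2 - 1" by linarith
  qed
  have q: "2 ^ (M - 2) * (\<Prod>j=1..M-1. 4 * (real j)\<^sup>2 - 1) \<ge> 1 * 1"
    by (rule mult_mono) (use p in auto)
  have "{2..M} = insert M {2..<M}" using assms by auto
  then have "(\<Prod>j=2..M. S j) = S M * (\<Prod>j=2..<M. S j)" by simp
  also have "S M * 1 \<le> \<dots>"
    using S_ge_1[of M] assms by (intro mult_left_mono prod_ge_1 S_ge_1) auto
  finally have r: "S M \<le> (\<Prod>j=2..M. S j)" by simp
  have "1 * S M \<le> c_const M"
    unfolding c_const_def S_def[symmetric]
    using q r S_ge_1[of M] assms by (intro mult_mono) auto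
  then show "(\<Sum>i<M. 1 / (fact i)\<^sup>2) \<le> c_const M" "1 \<le> c_const M"
    using S_ge_1[of M] assms by (simp_all add: S_eq)
qed

text \<open>The summand \<open>m = 1\<close> is \<open>g 1 / g 1\<close>, and the others are
  nonnegative.\<close>

lemma sum_ratio_running_Min_ge_1:
  fixes g :: "nat \<Rightarrow> real"
  assumes "\<And>m. 1 \<le> m \<Longrightarrow> m \<le> l \<Longrightarrow> g m > 0" and "l \<ge> 1"
  shows "(\<Sum>m=1..l. g m / Min (g ` {1..m})) \<ge> 1"
proof -
  have Min_pos: "Min (g ` {1..m}) > 0" if "1 \<le> m" "m \<le> l" for m
    using that assms by (subst Min_gr_iff) auto
  have "(\<Sum>m\<in>{1}. g m / Min (g ` {1..m})) \<le> (\<Sum>m=1..l. g m / Min (g ` {1..m}))"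
    using assms Min_pos by (intro sum_mono2) (auto intro!: divide_nonneg_pos intro: less_imp_le)
  then show ?thesis using assms(1)[of 1] assms(2) by simp
qed

section \<open>Adjoints and Jordan decompositions\<close>

lemma mat_adjoint_dim [simp]:
  "dim_row (mat_adjoint A) = dim_col A" "dim_col (mat_adjoint A) = dim_row A"
  by (simp_all add: mat_adjoint_def)

lemma mat_adjoint_carrier [simp]: "A \<in> carrier_mat n m \<Longrightarrow> mat_adjoint A \<in> carrier_mat m n"
  unfolding carrier_mat_def by auto

lemma mat_adjoint_index [simp]:
  "i < dim_col A \<Longrightarrow> j < dim_row A \<Longrightarrow> mat_adjoint A $$ (i, j) = conjugate (A $$ (j, i))"
  by (simp add: mat_adjoint_def mat_of_rows_def)

lemma mat_adjoint_adjoint [simp]: "mat_adjoint (mat_adjoint A) = A"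
  by (rule eq_matI) auto

lemma mat_adjoint_one [simp]: "mat_adjoint (1\<^sub>m n) = (1\<^sub>m n :: complex mat)"
  by (rule eq_matI) auto

lemma mat_adjoint_mult:
  fixes A B :: "complex mat"
  assumes "A \<in> carrier_mat n m" "B \<in> carrier_mat m k"
  shows "mat_adjoint (A * B) = mat_adjoint B * mat_adjoint A"
  using assms by (intro eq_matI) (auto simp: scalar_prod_def mult.commute)

lemma mult_mat_zero_vec [simp]:
  fixes A :: "complex mat"
  shows "A \<in> carrier_mat n m \<Longrightarrow> A *\<^sub>v 0\<^sub>v m = 0\<^sub>v n"
  by (rule eq_vecI) auto

lemma cscalar_prod_sum: "x \<bullet>c y = (\<Sum>i<dim_vec y. x $ i * cnj (y $ i))"
  by (simp add: scalar_prod_def atLeast0LessThan)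

lemma cscalar_prod_adjoint:
  fixes A :: "complex mat"
  assumes "A \<in> carrier_mat n m" "x \<in> carrier_vec m" "y \<in> carrier_vec n"
  shows "(A *\<^sub>v x) \<bullet>c y = x \<bullet>c (mat_adjoint A *\<^sub>v y)"
proof -
  have "(A *\<^sub>v x) \<bullet>c y = (\<Sum>i<n. \<Sum>j<m. A $$ (i, j) * x $ j * cnj (y $ i))"
    using assms by (simp add: cscalar_prod_sum scalar_prod_def atLeast0LessThan sum_distrib_right)
  also have "\<dots> = (\<Sum>j<m. \<Sum>i<n. A $$ (i, j) * x $ j * cnj (y $ i))"
    by (rule sum.swap)
  also have "\<dots> = x \<bullet>c (mat_adjoint A *\<^sub>v y)"
    using assms by (simp add: cscalar_prod_sum scalar_prod_def atLeast0LessThan sum_distrib_left mult_ac)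
  finally show ?thesis .
qed

lemma eucl_norm_power2: "(eucl_norm x)\<^sup>2 = (\<Sum>i<dim_vec x. (cmod (x $ i))\<^sup>2)"
  by (simp add: eucl_norm_def L2_set_def sum_nonneg)

lemma cscalar_prod_self: "x \<bullet>c x = of_real ((eucl_norm x)\<^sup>2)"
  unfolding eucl_norm_power2 cscalar_prod_sum of_real_sum complex_norm_square ..

lemma eucl_norm_pos: "x \<in> carrier_vec n \<Longrightarrow> x \<noteq> 0\<^sub>v n \<Longrightarrow> eucl_norm x > 0"
proof -
  assume x: "x \<in> carrier_vec n" "x \<noteq> 0\<^sub>v n"
  then obtain i where "i < n" "x $ i \<noteq> 0" by (metis eq_vecI carrier_vecD index_zero_vec)
  then show ?thesis using x
    by (auto simp: eucl_norm_def L2_set_nonneg order_less_le L2_set_eq_0_iff)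
qed

lemma similar_mat_adjoint:
  fixes A B :: "complex mat"
  assumes "similar_mat A B"
  shows "similar_mat (mat_adjoint A) (mat_adjoint B)"
proof -
  obtain n P Q where "{A, B, P, Q} \<subseteq> carrier_mat n n"
    and PQ: "P * Q = 1\<^sub>m n" "Q * P = 1\<^sub>m n" and A: "A = P * B * Q"
    using similar_matD[OF assms] by blast
  then have carrier: "A \<in> carrier_mat n n" "B \<in> carrier_mat n n" "P \<in> carrier_mat n n" "Q \<in> carrier_mat n n"
    by auto
  have "mat_adjoint A = mat_adjoint Q * (mat_adjoint B * mat_adjoint P)"
    unfolding A mat_adjoint_mult[OF mult_carrier_mat[OF carrier(3,2)] carrier(4)]
      mat_adjoint_mult[OF carrier(3,2)] ..
  also have "\<dots> = mat_adjoint Q * mat_adjoint B * mat_adjoint P"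
    by (rule assoc_mult_mat[symmetric]) (use carrier in auto)
  finally have "mat_adjoint A = mat_adjoint Q * mat_adjoint B * mat_adjoint P" .
  moreover have "mat_adjoint Q * mat_adjoint P = 1\<^sub>m n" "mat_adjoint P * mat_adjoint Q = 1\<^sub>m n"
    unfolding mat_adjoint_mult[OF carrier(3,4), symmetric] mat_adjoint_mult[OF carrier(4,3), symmetric] PQ
    by simp_all
  ultimately show ?thesis
    using carrier by (intro similar_matI[of _ _ "mat_adjoint Q" "mat_adjoint P" n]) auto
qed

text \<open>Reversing the order of the basis turns the transpose of a Jordan block back into the block.\<close>

lemma similar_mat_adjoint_jordan_block:
  "similar_mat (mat_adjoint (jordan_block n a)) (jordan_block n (cnj a))"
proof -
  define R :: "complex mat" where "R = mat n n (\<lambda>(i, j). if i + j + 1 = n then 1 else 0)"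
  have R: "R \<in> carrier_mat n n" by (simp add: R_def)
  have left: "(R * B) $$ (i, j) = B $$ (n - 1 - i, j)"
    if "B \<in> carrier_mat n n" "i < n" "j < n" for B i j
  proof -
    have "(R * B) $$ (i, j) = (\<Sum>k<n. R $$ (i, k) * B $$ (k, j))"
      using that R by (simp add: scalar_prod_def atLeast0LessThan)
    also have "\<dots> = (\<Sum>k<n. if k = n - 1 - i then B $$ (k, j) else 0)"
      using that by (intro sum.cong) (auto simp: R_def)
    finally show ?thesis using that by simp
  qed
  have right: "(B * R) $$ (i, j) = B $$ (i, n - 1 - j)"
    if "B \<in> carrier_mat n n" "i < n" "j < n" for B i j
  proof -
    have "(B * R) $$ (i, j) = (\<Sum>k<n. B $$ (i, k) * R $$ (k, j))"
      using that R by (simp add: scalar_prod_def atLeast0LessThan)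
    also have "\<dots> = (\<Sum>k<n. if k = n - 1 - j then B $$ (i, k) else 0)"
      using that by (intro sum.cong) (auto simp: R_def)
    finally show ?thesis using that by simp
  qed
  have "R * R = 1\<^sub>m n"
    using R by (intro eq_matI) (auto simp: left simp del: index_mult_mat(1), auto simp: R_def)
  moreover have "mat_adjoint (jordan_block n a) = R * jordan_block n (cnj a) * R"
    using R by (intro eq_matI) (auto simp: right left[of "jordan_block n (cnj a)"] simp del: index_mult_mat(1))
  ultimately show ?thesis
    using R by (intro similar_matI[of _ _ R R n]) auto
qed

lemma similar_mat_adjoint_jordan_matrix:
  "similar_mat (mat_adjoint (jordan_matrix bs)) (jordan_matrix (map (\<lambda>(l, z). (l, cnj z)) bs))"
proof (induction bs)
  case Nil
  have "mat_adjoint (jordan_matrix []) = (jordan_matrix [] :: complex mat)"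
    by (rule eq_matI) (simp_all only: mat_adjoint_dim jordan_matrix_dim list.map sum_list.Nil not_less_zero)
  then show ?case
    using similar_mat_refl[OF jordan_matrix_carrier[of "[] :: (nat \<times> complex) list"]] by (simp only: list.map)
next
  case (Cons b bs)
  obtain l z where b: "b = (l, z)" by force
  let ?m = "sum_list (map fst bs)"
  have fst_map: "map fst (map (\<lambda>(l, z). (l, cnj z)) bs) = map fst bs"
    by (induction bs) auto
  have "mat_adjoint (jordan_matrix (b # bs)) = four_block_mat (mat_adjoint (jordan_block l z))
      (0\<^sub>m l ?m) (0\<^sub>m ?m l) (mat_adjoint (jordan_matrix bs))"
    unfolding b jordan_matrix_Cons
    by (rule eq_matI) (auto simp del: jordan_block_index simp: jordan_block_index(2,3))
  also have "similar_mat \<dots> (four_block_mat (jordan_block l (cnj z))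
      (0\<^sub>m l ?m) (0\<^sub>m ?m l) (jordan_matrix (map (\<lambda>(l, z). (l, cnj z)) bs)))"
    by (rule similar_mat_four_block_0_0[OF similar_mat_adjoint_jordan_block Cons]) auto
  also have "four_block_mat (jordan_block l (cnj z)) (0\<^sub>m l ?m) (0\<^sub>m ?m l)
      (jordan_matrix (map (\<lambda>(l, z). (l, cnj z)) bs)) = jordan_matrix (map (\<lambda>(l, z). (l, cnj z)) (b # bs))"
    by (simp only: b list.map prod.case jordan_matrix_Cons fst_map)
  finally show ?case .
qed

text \<open>The decomposition is given for the adjoint, while \<mu> and the maximal block size refer
  to the matrix itself; this carries the blocks over.\<close>

lemma jordan_nf_adjoint:
  fixes A :: "complex mat"
  assumes "jordan_nf (mat_adjoint A) bs"
  shows "jordan_nf A (map (\<lambda>(l, z). (l, cnj z)) bs)"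
proof -
  have "similar_mat A (mat_adjoint (jordan_matrix bs))"
    using similar_mat_adjoint[of "mat_adjoint A"] assms by (auto simp: jordan_nf_def)
  then have "similar_mat A (jordan_matrix (map (\<lambda>(l, z). (l, cnj z)) bs))"
    by (rule similar_mat_trans) (rule similar_mat_adjoint_jordan_matrix)
  moreover have "0 \<notin> fst ` set (map (\<lambda>(l, z). (l, cnj z)) bs)"
    using assms by (force simp: jordan_nf_def)
  ultimately show ?thesis by (simp add: jordan_nf_def)
qed

lemma jordan_nf_iff_jordan_decomp: "jordan_nf A bs \<longleftrightarrow> (\<exists>V. jordan_decomp A bs V)"
  by (auto simp: jordan_nf_def jordan_decomp_def similar_mat_def)

section \<open>Numbering columns by block and position\<close>

lemma offset_less_sum:
  fixes l :: "nat \<Rightarrow> nat"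
  assumes "n < N" "k < l n"
  shows "(\<Sum>i<n. l i) + k < (\<Sum>i<N. l i)"
proof -
  have "(\<Sum>i<n. l i) + k < (\<Sum>i<Suc n. l i)" using assms by simp
  also have "\<dots> \<le> (\<Sum>i<N. l i)" using assms by (intro sum_mono2) auto
  finally show ?thesis .
qed

lemma offset_decomposition:
  fixes l :: "nat \<Rightarrow> nat"
  assumes "j < (\<Sum>i<N. l i)"
  shows "\<exists>n<N. \<exists>k<l n. j = (\<Sum>i<n. l i) + k"
  using assms
proof (induction N)
  case (Suc N)
  show ?case
  proof (cases "j < (\<Sum>i<N. l i)")
    case True
    then show ?thesis using Suc.IH less_SucI by blast
  next
    case False
    then show ?thesis using Suc.prems
      by (intro exI[of _ N] conjI exI[of _ "j - (\<Sum>i<N. l i)"]) auto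
  qed
qed simp

lemma sum_list_fst_eq_len: "sum_list (map fst bs) = (\<Sum>n<length bs. len bs n)"
  by (simp add: sum_list_sum_nth atLeast0LessThan len_def)

text \<open>The condition \<open>k > 0\<close> excludes the first column of a block, where the entry
  above the diagonal lies outside the block. The induction removes the first block, which shifts
  rows and offsets by its size.\<close>

lemma jordan_matrix_index:
  assumes "n < length bs" "k < len bs n" "i < sum_list (map fst bs)"
  shows "jordan_matrix bs $$ (i, (\<Sum>j<n. len bs j) + k) =
    (if i = (\<Sum>j<n. len bs j) + k then snd (bs ! n)
     else if k > 0 \<and> Suc i = (\<Sum>j<n. len bs j) + k then 1 else 0)"
  using assms
proof (induction bs arbitrary: n i)
  case (Cons b bs)
  obtain l z where b: "b = (l, z)" by force
  show ?case
  proof (cases n)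
    case 0
    then show ?thesis using Cons.prems by (auto simp: b jordan_matrix_Cons len_def)
  next
    case (Suc n')
    have off: "(\<Sum>j<n. len (b # bs) j) = l + (\<Sum>j<n'. len bs j)"
      unfolding Suc sum.lessThan_Suc_shift by (simp add: b len_def)
    have n': "n' < length bs" "k < len bs n'" using Cons.prems by (auto simp: Suc len_def)
    have less: "(\<Sum>j<n'. len bs j) + k < sum_list (map fst bs)"
      unfolding sum_list_fst_eq_len using n' by (rule offset_less_sum)
    show ?thesis
    proof (cases "i < l")
      case True
      then show ?thesis using less Cons.prems unfolding off by (auto simp: b jordan_matrix_Cons Suc)
    next
      case False
      then have "i - l < sum_list (map fst bs)" using Cons.prems by (auto simp: b)
      from Cons.IH[OF n' this] show ?thesis
        using False less Cons.prems unfolding off by (auto simp: b jordan_matrix_Cons Suc)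
    qed
  qed
qed simp

text \<open>Kept general in \<open>A\<close> because it serves three matrices:
  \<open>mat_adjoint C\<close>, \<open>C\<close> itself, and the Hermitian matrices of the Rayleigh
  bounds.\<close>

locale jordan_decomposition =
  fixes d :: nat and A V :: "complex mat" and bs :: "(nat \<times> complex) list"
  assumes A: "A \<in> carrier_mat d d" and decomp: "jordan_decomp A bs V"
begin

lemma obtain_inverse:
  obtains W where "V \<in> carrier_mat d d" "W \<in> carrier_mat d d" "V * W = 1\<^sub>m d" "W * V = 1\<^sub>m d"
    "A * V = V * jordan_matrix bs" "jordan_matrix bs \<in> carrier_mat d d"
proof -
  obtain W where "similar_mat_wit A (jordan_matrix bs) V W"
    using decomp by (auto simp: jordan_decomp_def)
  note * = similar_mat_witD2[OF A this]
  have "A * V = V * jordan_matrix bs * W * V"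
    by (rule arg_cong[OF *(3)])
  also have "\<dots> = V * jordan_matrix bs * (W * V)"
    by (rule assoc_mult_mat[OF mult_carrier_mat]) fact+
  also have "\<dots> = V * jordan_matrix bs"
    unfolding *(2) by (rule right_mult_one_mat[OF mult_carrier_mat]) fact+
  finally show ?thesis by (rule that[OF *(6,7,1,2) _ *(5)])
qed

lemma V_carrier: "V \<in> carrier_mat d d"
  by (rule obtain_inverse, assumption)

lemma chain_vec_carrier [simp]: "chain_vec bs V n k \<in> carrier_vec d"
  using V_carrier unfolding chain_vec_def by (metis carrier_matD(1) col_dim)

lemma sum_len: "(\<Sum>n<length bs. len bs n) = d"
proof -
  have "jordan_matrix bs \<in> carrier_mat d d" by (rule obtain_inverse, assumption)
  then show ?thesis unfolding sum_list_fst_eq_len[symmetric] by (metis carrier_matD(1) jordan_matrix_dim(1))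
qed

lemma len_pos: "n < length bs \<Longrightarrow> len bs n > 0"
  using decomp nth_mem[of n bs] imageI[of "bs ! n" "set bs" fst]
  by (cases "len bs n = 0") (auto simp: jordan_decomp_def len_def)

lemma offset_less: "n < length bs \<Longrightarrow> k < len bs n \<Longrightarrow> (\<Sum>i<n. len bs i) + k < d"
  using offset_less_sum[of n "length bs" k "len bs"] sum_len by simp

lemma chain_vec_nonzero:
  assumes "n < length bs" "k < len bs n"
  shows "chain_vec bs V n k \<noteq> 0\<^sub>v d"
proof
  assume zero: "chain_vec bs V n k = 0\<^sub>v d"
  obtain W where W: "W \<in> carrier_mat d d" "W * V = 1\<^sub>m d" using obtain_inverse by blast
  define j where "j = (\<Sum>i<n. len bs i) + k"
  have j: "j < d" using offset_less[OF assms] by (simp add: j_def)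
  have "col (W * V) j = W *\<^sub>v 0\<^sub>v d"
    using col_mult2[OF W(1) V_carrier j] zero by (simp only: chain_vec_def j_def)
  also have "\<dots> = 0\<^sub>v d" using W(1) by (rule mult_mat_zero_vec)
  finally have "col (1\<^sub>m d) j = (0\<^sub>v d :: complex vec)" using W by simp
  from arg_cong[OF this, of "\<lambda>v. v $ j"] j show False by simp
qed

text \<open>This is one column of \<open>A * V = V * J\<close>, with \<open>J\<close> the Jordan
  matrix.\<close>

lemma mult_chain_vec:
  assumes "n < length bs" "k < len bs n"
  shows "A *\<^sub>v chain_vec bs V n k = snd (bs ! n) \<cdot>\<^sub>v chain_vec bs V n k +
    (if k = 0 then 0\<^sub>v d else chain_vec bs V n (k - 1))"
proof (rule eq_vecI)
  define j where "j = (\<Sum>i<n. len bs i) + k"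
  have j: "j < d" using offset_less[OF assms] by (simp add: j_def)
  define J where "J = jordan_matrix bs"
  have J: "A * V = V * J" "J \<in> carrier_mat d d"
    unfolding J_def by (rule obtain_inverse, assumption)+
  fix i assume "i < dim_vec (snd (bs ! n) \<cdot>\<^sub>v chain_vec bs V n k +
    (if k = 0 then 0\<^sub>v d else chain_vec bs V n (k - 1)))"
  then have i: "i < d" using V_carrier by (auto simp: chain_vec_def split: if_splits)
  have "(A *\<^sub>v chain_vec bs V n k) $ i = (V * J) $$ (i, j)"
    using A V_carrier i j unfolding J(1)[symmetric] by (simp add: chain_vec_def j_def)
  also have "\<dots> = (\<Sum>m<d. V $$ (i, m) * J $$ (m, j))"
    using V_carrier J(2) i j by (simp add: scalar_prod_def atLeast0LessThan)
  \<comment> \<open>For \<open>j = 0\<close> the truncated \<open>j - 1\<close> is again 0, but then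
    \<open>k = 0\<close> and the second summand vanishes.\<close>
  also have "\<dots> = (\<Sum>m<d. (if m = j then V $$ (i, m) * snd (bs ! n) else 0) +
      (if m = j - 1 then if k = 0 then 0 else V $$ (i, m) else 0))"
    unfolding j_def J_def using jordan_matrix_index[OF assms] sum_len
    by (intro sum.cong refl) (auto simp: sum_list_fst_eq_len)
  also have "\<dots> = V $$ (i, j) * snd (bs ! n) + (if k = 0 then 0 else V $$ (i, j - 1))"
    using j by (simp add: sum.distrib)
  also have "\<dots> = (snd (bs ! n) \<cdot>\<^sub>v chain_vec bs V n k +
    (if k = 0 then 0\<^sub>v d else chain_vec bs V n (k - 1))) $ i"
    using V_carrier i j by (auto simp: chain_vec_def j_def)
  finally show "(A *\<^sub>v chain_vec bs V n k) $ i = (snd (bs ! n) \<cdot>\<^sub>v chain_vec bs V n k +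
    (if k = 0 then 0\<^sub>v d else chain_vec bs V n (k - 1))) $ i" .
qed (use A V_carrier in \<open>auto simp: chain_vec_def\<close>)

lemma eigenvalue_in_spectrum:
  assumes "n < length bs"
  shows "snd (bs ! n) \<in> spectrum A"
proof -
  have "A *\<^sub>v chain_vec bs V n 0 = snd (bs ! n) \<cdot>\<^sub>v chain_vec bs V n 0"
    using mult_chain_vec[OF assms len_pos[OF assms]] by (simp add: right_zero_vec[of _ d])
  then show ?thesis
    using A chain_vec_nonzero[OF assms len_pos[OF assms]]
    by (auto simp: spectrum_def eigenvalue_def eigenvector_def intro!: exI[of _ "chain_vec bs V n 0"])
qed

text \<open>Orthogonality to all columns of \<open>V\<close> means that the adjoint of
  \<open>V\<close> kills \<open>x\<close>, and this adjoint is invertible. Strict positivity of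
  \<open>P0\<close> rests on it.\<close>

lemma exists_chain_vec_not_orthogonal:
  assumes x: "x \<in> carrier_vec d" "x \<noteq> 0\<^sub>v d"
  shows "\<exists>n<length bs. \<exists>k<len bs n. x \<bullet>c chain_vec bs V n k \<noteq> 0"
proof (rule ccontr)
  assume *: "\<not> ?thesis"
  have **: "x \<bullet>c col V j = 0" if "j < d" for j
    using offset_decomposition[of j "len bs" "length bs"] that * sum_len
    by (auto simp: chain_vec_def)
  obtain W where W: "W \<in> carrier_mat d d" "V * W = 1\<^sub>m d" using obtain_inverse by blast
  have "mat_adjoint V *\<^sub>v x = 0\<^sub>v d"
  proof (rule eq_vecI)
    fix j assume "j < dim_vec (0\<^sub>v d :: complex vec)"
    then have "(mat_adjoint V *\<^sub>v x) $ j = x \<bullet>c col V j"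
      using V_carrier x by (simp add: cscalar_prod_sum scalar_prod_def atLeast0LessThan mult.commute)
    then show "(mat_adjoint V *\<^sub>v x) $ j = 0\<^sub>v d $ j" using ** \<open>j < _\<close> by simp
  qed (use V_carrier in auto)
  moreover have "mat_adjoint W * mat_adjoint V = 1\<^sub>m d"
    using W V_carrier by (simp add: mat_adjoint_mult[of _ d d _ d, symmetric])
  then have "x = mat_adjoint W *\<^sub>v (mat_adjoint V *\<^sub>v x)"
    using W V_carrier x by (simp add: assoc_mult_mat_vec[of _ d d _ d, symmetric])
  moreover have "mat_adjoint W *\<^sub>v 0\<^sub>v d = 0\<^sub>v d"
    using W by (intro mult_mat_zero_vec) simp
  ultimately show False using x by simp
qed

end

section \<open>Rayleigh bounds for Hermitian matrices\<close>

text \<open>Expansion by the Gram matrix of the columns, which are not assumed orthogonal: the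
  eigenbasis obtained below need not be.\<close>

lemma cscalar_prod_mult_mat_vec:
  fixes V :: "complex mat"
  assumes "V \<in> carrier_mat n m" "p \<in> carrier_vec m" "q \<in> carrier_vec m"
  shows "(V *\<^sub>v p) \<bullet>c (V *\<^sub>v q) =
    (\<Sum>j<m. \<Sum>k<m. p $ j * cnj (q $ k) * (col V j \<bullet>c col V k))"
proof -
  have "(V *\<^sub>v p) \<bullet>c (V *\<^sub>v q) =
      (\<Sum>i<n. (\<Sum>j<m. V $$ (i, j) * p $ j) * (\<Sum>k<m. cnj (V $$ (i, k) * q $ k)))"
    using assms by (simp add: cscalar_prod_sum scalar_prod_def atLeast0LessThan)
  also have "\<dots> = (\<Sum>i<n. \<Sum>j<m. \<Sum>k<m. p $ j * cnj (q $ k) * (V $$ (i, j) * cnj (V $$ (i, k))))"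
    unfolding sum_product by (intro sum.cong refl) (simp add: mult_ac)
  also have "\<dots> = (\<Sum>j<m. \<Sum>i<n. \<Sum>k<m. p $ j * cnj (q $ k) * (V $$ (i, j) * cnj (V $$ (i, k))))"
    by (rule sum.swap)
  also have "\<dots> = (\<Sum>j<m. \<Sum>k<m. \<Sum>i<n. p $ j * cnj (q $ k) * (V $$ (i, j) * cnj (V $$ (i, k))))"
    by (intro sum.cong refl sum.swap)
  also have "\<dots> = (\<Sum>j<m. \<Sum>k<m. p $ j * cnj (q $ k) * (col V j \<bullet>c col V k))"
    using assms by (intro sum.cong refl) (simp add: cscalar_prod_sum sum_distrib_left)
  finally show ?thesis .
qed

text \<open>Taken from a Jordan decomposition: symmetry makes the eigenvalues real and rules out
  blocks longer than 1, so all columns of \<open>V\<close> are eigenvectors.\<close>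

lemma hermitian_eigenbasis:
  fixes A :: "complex mat"
  assumes A: "A \<in> carrier_mat d d" and hermitian: "mat_adjoint A = A"
  obtains V W e where "V \<in> carrier_mat d d" "W \<in> carrier_mat d d" "V * W = 1\<^sub>m d"
    "\<And>j. j < d \<Longrightarrow> A *\<^sub>v col V j = of_real (e j) \<cdot>\<^sub>v col V j" "\<And>j. j < d \<Longrightarrow> of_real (e j) \<in> spectrum A"
proof -
  obtain as where "char_poly A = (\<Prod>a\<leftarrow>as. [:- a, 1:])"
    using char_poly_factorized[OF A] by blast
  then obtain bs V where decomp: "jordan_decomp A bs V"
    using jordan_nf_exists[OF A] jordan_nf_iff_jordan_decomp by metis
  interpret jordan_decomposition d A V bs
    by unfold_locales fact+
  note sym = cscalar_prod_adjoint[OF A, unfolded hermitian]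
  have eigen: "A *\<^sub>v chain_vec bs V n 0 = snd (bs ! n) \<cdot>\<^sub>v chain_vec bs V n 0" if "n < length bs" for n
    using mult_chain_vec[OF that len_pos[OF that]] by (simp add: right_zero_vec[of _ d])
  have pos: "chain_vec bs V n 0 \<bullet>c chain_vec bs V n 0 \<noteq> 0" if "n < length bs" for n
    using eucl_norm_pos[OF chain_vec_carrier chain_vec_nonzero[OF that len_pos[OF that]]]
    unfolding cscalar_prod_self by simp
  have real: "cnj (snd (bs ! n)) = snd (bs ! n)" if "n < length bs" for n
    using sym[of "chain_vec bs V n 0" "chain_vec bs V n 0"] pos[OF that]
    by (simp add: eigen[OF that] conjugate_smult_vec smult_scalar_prod_distrib[of _ d] scalar_prod_smult_distrib[of _ d])
  \<comment> \<open>For a chain vector \<open>v1\<close> above the eigenvector \<open>v0\<close>,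
    moving \<open>A\<close> across the product of \<open>v1\<close> and \<open>v0\<close> cancels
    the eigenvalue terms, since the eigenvalue is real, and leaves the squared norm of
    \<open>v0\<close> equal to 0.\<close>
  have len_1: "len bs n = 1" if "n < length bs" for n
  proof (rule ccontr)
    assume "len bs n \<noteq> 1"
    then have "1 < len bs n" using len_pos[OF that] by simp
    from mult_chain_vec[OF that this]
    have "A *\<^sub>v chain_vec bs V n 1 = snd (bs ! n) \<cdot>\<^sub>v chain_vec bs V n 1 + chain_vec bs V n 0" by simp
    with sym[of "chain_vec bs V n 1" "chain_vec bs V n 0"] pos[OF that]
    show False
      by (simp add: eigen[OF that] real[OF that] conjugate_smult_vec smult_scalar_prod_distrib[of _ d]
          scalar_prod_smult_distrib[of _ d] add_scalar_prod_distrib[of _ d])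
  qed
  obtain W where W: "W \<in> carrier_mat d d" "V * W = 1\<^sub>m d" using obtain_inverse by blast
  have *: "\<exists>n<length bs. col V j = chain_vec bs V n 0" if "j < d" for j
    using offset_decomposition[of j "len bs" "length bs"] that len_1 sum_len
    by (auto simp: chain_vec_def)
  then obtain n where n: "\<And>j. j < d \<Longrightarrow> n j < length bs"
    "\<And>j. j < d \<Longrightarrow> col V j = chain_vec bs V (n j) 0" by metis
  have e: "of_real (Re (snd (bs ! n j))) = snd (bs ! n j)" if "j < d" for j
    using real[OF n(1)[OF that]] by (simp add: complex_eq_iff)
  show ?thesis
    using that[OF V_carrier W, of "\<lambda>j. Re (snd (bs ! n j))"] n e eigen eigenvalue_in_spectrum by simp
qed

text \<open>Expanding \<open>x\<close> in eigenvectors with coefficients \<open>c j\<close>, the quadratic form below is the squared norm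
  of the vector with coefficients \<open>sqrt (a * e j + b) * c j\<close>, since eigenvectors to different eigenvalues are
  orthogonal; the basis need not be orthogonal within an eigenspace.\<close>

lemma hermitian_quadratic_form_nonneg:
  fixes A :: "complex mat"
  assumes A: "A \<in> carrier_mat d d" and hermitian: "mat_adjoint A = A"
    and spec: "\<And>z. z \<in> spectrum A \<Longrightarrow> 0 \<le> a * Re z + b" and x: "x \<in> carrier_vec d"
  shows "0 \<le> a * Re ((A *\<^sub>v x) \<bullet>c x) + b * (eucl_norm x)\<^sup>2"
proof -
  obtain V W e where V: "V \<in> carrier_mat d d" and W: "W \<in> carrier_mat d d" "V * W = 1\<^sub>m d"
    and eigen: "\<And>j. j < d \<Longrightarrow> A *\<^sub>v col V j = of_real (e j) \<cdot>\<^sub>v col V j"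
    and e: "\<And>j. j < d \<Longrightarrow> of_real (e j) \<in> spectrum A"
    using hermitian_eigenbasis[OF A hermitian] by metis
  define c where "c = W *\<^sub>v x"
  define r where "r = (\<lambda>j. sqrt (a * e j + b))"
  define y where "y = vec d (\<lambda>j. of_real (r j) * c $ j)"
  have c: "c \<in> carrier_vec d" "x = V *\<^sub>v c"
    using V W x by (simp_all add: c_def assoc_mult_mat_vec[of _ d d _ d, symmetric])
  have Ax: "A *\<^sub>v x = V *\<^sub>v vec d (\<lambda>j. of_real (e j) * c $ j)"
  proof (rule eq_vecI)
    fix i assume "i < dim_vec (V *\<^sub>v vec d (\<lambda>j. of_real (e j) * c $ j))"
    then have i: "i < d" using V by simp
    define B where "B = A * V"
    have "B \<in> carrier_mat d d" using A V by (simp add: B_def)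
    have "(A *\<^sub>v x) $ i = (B *\<^sub>v c) $ i"
      unfolding B_def using A V c by (simp add: assoc_mult_mat_vec[of _ d d _ d])
    also have "\<dots> = (\<Sum>j<d. B $$ (i, j) * c $ j)"
      using \<open>B \<in> _\<close> c i by (simp add: scalar_prod_def atLeast0LessThan)
    also have "\<dots> = (\<Sum>j<d. (A *\<^sub>v col V j) $ i * c $ j)"
      unfolding B_def using A V i by (intro sum.cong) auto
    also have "\<dots> = (\<Sum>j<d. V $$ (i, j) * (of_real (e j) * c $ j))"
      using V i by (intro sum.cong refl) (simp add: eigen)
    finally show "(A *\<^sub>v x) $ i = (V *\<^sub>v vec d (\<lambda>j. of_real (e j) * c $ j)) $ i"
      using V i by (simp add: scalar_prod_def atLeast0LessThan)
  qed (use A V in auto)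
  have orth: "e j = e k" if "col V j \<bullet>c col V k \<noteq> 0" "j < d" "k < d" for j k
  proof -
    have "(A *\<^sub>v col V j) \<bullet>c col V k = col V j \<bullet>c (A *\<^sub>v col V k)"
      using cscalar_prod_adjoint[OF A, of "col V j" "col V k"] V that by (simp add: hermitian)
    then show ?thesis
      using V that by (simp add: eigen conjugate_smult_vec smult_scalar_prod_distrib[of _ d] scalar_prod_smult_distrib[of _ d])
  qed
  have "of_real a * ((A *\<^sub>v x) \<bullet>c x) + of_real b * (x \<bullet>c x) =
      of_real a * (\<Sum>j<d. \<Sum>k<d. of_real (e j) * c $ j * cnj (c $ k) * (col V j \<bullet>c col V k)) +
      of_real b * (\<Sum>j<d. \<Sum>k<d. c $ j * cnj (c $ k) * (col V j \<bullet>c col V k))"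
    unfolding Ax unfolding c(2) using c(1) by (simp add: cscalar_prod_mult_mat_vec[OF V])
  also have "\<dots> = (\<Sum>j<d. \<Sum>k<d. of_real (a * e j + b) * c $ j * cnj (c $ k) * (col V j \<bullet>c col V k))"
    unfolding sum_distrib_left sum.distrib[symmetric] by (intro sum.cong refl) (simp add: algebra_simps)
  also have "\<dots> = (\<Sum>j<d. \<Sum>k<d. y $ j * cnj (y $ k) * (col V j \<bullet>c col V k))"
  proof (intro sum.cong refl)
    fix j k assume "j \<in> {..<d}" "k \<in> {..<d}"
    then have jk: "j < d" "k < d" by auto
    show "of_real (a * e j + b) * c $ j * cnj (c $ k) * (col V j \<bullet>c col V k) =
        y $ j * cnj (y $ k) * (col V j \<bullet>c col V k)"
    proof (cases "col V j \<bullet>c col V k = 0")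
      case False
      then have "r k = r j" using orth jk by (simp add: r_def)
      have "a * e j + b = r j * r j" using spec[OF e[OF jk(1)]] by (simp add: r_def)
      then have "of_real (a * e j + b) = complex_of_real (r j) * of_real (r j)"
        unfolding of_real_mult[symmetric] by (rule arg_cong)
      then show ?thesis
        unfolding y_def using jk \<open>r k = r j\<close> by simp
    qed simp
  qed
  also have "\<dots> = (V *\<^sub>v y) \<bullet>c (V *\<^sub>v y)"
    by (rule cscalar_prod_mult_mat_vec[OF V, symmetric]) (simp_all add: y_def)
  finally have "Re (of_real a * ((A *\<^sub>v x) \<bullet>c x) + of_real b * (x \<bullet>c x)) = (eucl_norm (V *\<^sub>v y))\<^sup>2"
    by (simp add: cscalar_prod_self)
  then show ?thesis by (simp add: cscalar_prod_self)
qed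

text \<open>Both bounds are instances of the preceding lemma: \<open>a = 1\<close>,
  \<open>b = - min_Re_ev A\<close> and \<open>a = - 1\<close>, \<open>b = max_Re_ev A\<close> make
  \<open>a * Re z + b\<close> nonnegative on the spectrum.\<close>

lemma hermitian_Rayleigh_bounds:
  fixes A :: "complex mat"
  assumes A: "A \<in> carrier_mat d d" and "mat_adjoint A = A" and x: "x \<in> carrier_vec d"
  shows "min_Re_ev A * (eucl_norm x)\<^sup>2 \<le> Re ((A *\<^sub>v x) \<bullet>c x)"
    and "Re ((A *\<^sub>v x) \<bullet>c x) \<le> max_Re_ev A * (eucl_norm x)\<^sup>2"
proof -
  have "min_Re_ev A \<le> Re z" "Re z \<le> max_Re_ev A" if "z \<in> spectrum A" for z
    using that card_finite_spectrum(1)[OF A] by (auto simp: min_Re_ev_def max_Re_ev_def)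
  then show "min_Re_ev A * (eucl_norm x)\<^sup>2 \<le> Re ((A *\<^sub>v x) \<bullet>c x)"
    "Re ((A *\<^sub>v x) \<bullet>c x) \<le> max_Re_ev A * (eucl_norm x)\<^sup>2"
    using hermitian_quadratic_form_nonneg[OF assms(1,2) _ x, of 1 "- min_Re_ev A"]
      hermitian_quadratic_form_nonneg[OF assms(1,2) _ x, of "- 1" "max_Re_ev A"] by auto
qed

lemma hermitian_pos_def_spectrum:
  assumes A: "A \<in> carrier_mat d d" and pd: "hermitian_pos_def A" and z: "z \<in> spectrum A"
  shows "Re z > 0"
proof -
  obtain v where v: "v \<in> carrier_vec d" "v \<noteq> 0\<^sub>v d" "A *\<^sub>v v = z \<cdot>\<^sub>v v"
    using z A by (auto simp: spectrum_def eigenvalue_def eigenvector_def)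
  have "0 < Re ((A *\<^sub>v v) \<bullet>c v)"
    using pd v A by (auto simp: hermitian_pos_def_def)
  also have "(A *\<^sub>v v) \<bullet>c v = z * of_real ((eucl_norm v)\<^sup>2)"
    using v by (simp add: smult_scalar_prod_distrib[of _ d] cscalar_prod_self)
  finally show ?thesis by (simp add: zero_less_mult_iff)
qed

section \<open>The quadratic form and its decay\<close>

text \<open>Each rank-one summand contributes a product of \<open>x \<bullet>c v s\<close> with its
  conjugate. The hypothesis is entrywise to match the entrywise sums in \<open>P0\<close>.\<close>

lemma rank_one_sum_quadratic_form:
  assumes P: "P \<in> carrier_mat d d" and x: "x \<in> carrier_vec d"
    and v: "\<And>s. s \<in> S \<Longrightarrow> v s \<in> carrier_vec d"
    and index: "\<And>a b. a < d \<Longrightarrow> b < d \<Longrightarrow>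
      P $$ (a, b) = (\<Sum>s\<in>S. of_real (w s) * (v s $ a * cnj (v s $ b)))"
  shows "(P *\<^sub>v x) \<bullet>c x = of_real (\<Sum>s\<in>S. w s * (cmod (x \<bullet>c v s))\<^sup>2)"
proof -
  have "(P *\<^sub>v x) \<bullet>c x = (\<Sum>a<d. \<Sum>b<d. P $$ (a, b) * x $ b * cnj (x $ a))"
    using P x by (simp add: cscalar_prod_sum scalar_prod_def atLeast0LessThan sum_distrib_right)
  also have "\<dots> = (\<Sum>a<d. \<Sum>b<d. \<Sum>s\<in>S. of_real (w s) * (v s $ a * cnj (v s $ b)) * x $ b * cnj (x $ a))"
    by (intro sum.cong refl) (simp add: index sum_distrib_right)
  also have "\<dots> = (\<Sum>a<d. \<Sum>s\<in>S. \<Sum>b<d. of_real (w s) * (v s $ a * cnj (v s $ b)) * x $ b * cnj (x $ a))"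
    by (intro sum.cong refl sum.swap)
  also have "\<dots> = (\<Sum>s\<in>S. \<Sum>a<d. \<Sum>b<d. of_real (w s) * (v s $ a * cnj (v s $ b)) * x $ b * cnj (x $ a))"
    by (rule sum.swap)
  also have "\<dots> = (\<Sum>s\<in>S. of_real (w s) * of_real ((cmod (x \<bullet>c v s))\<^sup>2))"
  proof (intro sum.cong refl)
    fix s assume s: "s \<in> S"
    have "(\<Sum>a<d. \<Sum>b<d. of_real (w s) * (v s $ a * cnj (v s $ b)) * x $ b * cnj (x $ a)) =
        of_real (w s) * ((\<Sum>a<d. cnj (x $ a * cnj (v s $ a))) * (\<Sum>b<d. x $ b * cnj (v s $ b)))"
      unfolding sum_product unfolding sum_distrib_left by (intro sum.cong refl) (simp add: mult_ac)
    also have "(\<Sum>b<d. x $ b * cnj (v s $ b)) = x \<bullet>c v s"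
      using v[OF s] by (simp add: cscalar_prod_sum)
    also have "(\<Sum>a<d. cnj (x $ a * cnj (v s $ a))) = cnj (x \<bullet>c v s)"
      using v[OF s] by (simp add: cscalar_prod_sum)
    finally show "(\<Sum>a<d. \<Sum>b<d. of_real (w s) * (v s $ a * cnj (v s $ b)) * x $ b * cnj (x $ a)) =
        of_real (w s) * of_real ((cmod (x \<bullet>c v s))\<^sup>2)"
      unfolding complex_norm_square by (simp only: mult.commute)
  qed
  finally show ?thesis by simp
qed

text \<open>The coefficient in \<open>P0\<close> of the outer product of chain vector
  \<open>k\<close>, with \<open>k\<close> counted from 0 whereas \<gamma> and the sums in
  \<open>P0\<close> count from 1: \<open>len + 1 - i\<close> at \<open>i = k + 1\<close> is
  \<open>len - k\<close>.\<close>

definition block_weight ::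
  "(nat \<times> complex) list \<Rightarrow> real \<Rightarrow> (nat \<Rightarrow> real) \<Rightarrow> (nat \<Rightarrow> nat \<Rightarrow> real) \<Rightarrow> nat \<Rightarrow> nat \<Rightarrow> real" where
  "block_weight bs \<mu> \<beta> \<gamma> n k =
    (if n \<in> I_mu bs \<mu> then \<gamma> n (Suc k) else \<beta> n * b_coeff bs \<mu> n (len bs n - k))"

text \<open>True also at real part \<mu>, where the base is 0, since its exponent is 0. Hence blocks
  of length 1 fit the common formula in \<open>block_weight\<close>.\<close>

lemma b_coeff_1 [simp]: "b_coeff bs \<mu> n (Suc 0) = 1"
  by (simp add: b_coeff_def)

context jordan_decomposition
begin

lemma dim_chain_vec [simp]: "dim_vec (chain_vec bs V n k) = d"
  using chain_vec_carrier by (rule carrier_vecD)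

lemma outer_prod_chain_vec [simp]:
  "dim_row (outer_prod (chain_vec bs V n k) (chain_vec bs V n k)) = d"
  "dim_col (outer_prod (chain_vec bs V n k) (chain_vec bs V n k)) = d"
  "a < d \<Longrightarrow> b < d \<Longrightarrow> outer_prod (chain_vec bs V n k) (chain_vec bs V n k) $$ (a, b) =
    chain_vec bs V n k $ a * cnj (chain_vec bs V n k $ b)"
  by (simp_all add: outer_prod_def)

lemma P_block_index:
  assumes "n < length bs" "a < d" "b < d"
  shows "P_block d bs V \<mu> n $$ (a, b) = (\<Sum>k<len bs n. of_real (b_coeff bs \<mu> n (len bs n - k)) *
    (chain_vec bs V n k $ a * cnj (chain_vec bs V n k $ b)))"
proof (cases "len bs n = 1")
  case True
  then show ?thesis using assms by (simp add: P_block_def)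
next
  case False
  have "P_block d bs V \<mu> n $$ (a, b) = (\<Sum>i=1..len bs n. of_real (b_coeff bs \<mu> n (len bs n + 1 - i)) *
      (chain_vec bs V n (i - 1) $ a * cnj (chain_vec bs V n (i - 1) $ b)))"
    using assms False by (simp add: P_block_def sum_mats_def)
  also have "\<dots> = (\<Sum>k<len bs n. of_real (b_coeff bs \<mu> n (len bs n - k)) *
      (chain_vec bs V n k $ a * cnj (chain_vec bs V n k $ b)))"
    by (rule sum.reindex_bij_witness[where i = Suc and j = "\<lambda>i. i - 1"]) (auto simp: Suc_diff_le)
  finally show ?thesis .
qed

lemma P_block_dim: "dim_row (P_block d bs V \<mu> n) = d" "dim_col (P_block d bs V \<mu> n) = d"
  by (simp_all add: P_block_def sum_mats_def)

lemma P0_carrier: "P0 d bs V \<mu> \<beta> \<gamma> \<in> carrier_mat d d"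
  unfolding P0_def sum_mats_def by (rule add_carrier_mat) (rule mat_carrier)

lemma P0_index:
  assumes "a < d" "b < d"
  shows "P0 d bs V \<mu> \<beta> \<gamma> $$ (a, b) =
    (\<Sum>(n, k)\<in>(SIGMA n:{..<length bs}. {..<len bs n}). of_real (block_weight bs \<mu> \<beta> \<gamma> n k) *
      (chain_vec bs V n k $ a * cnj (chain_vec bs V n k $ b)))"
proof -
  define f where "f = (\<lambda>n k. of_real (block_weight bs \<mu> \<beta> \<gamma> n k) *
      (chain_vec bs V n k $ a * cnj (chain_vec bs V n k $ b)))"
  have I: "I_mu bs \<mu> \<subseteq> {..<length bs}" by (auto simp: I_mu_def)
  have off: "(complex_of_real (\<beta> n) \<cdot>\<^sub>m P_block d bs V \<mu> n) $$ (a, b) = (\<Sum>k<len bs n. f n k)"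
    if "n \<in> {..<length bs} - I_mu bs \<mu>" for n
    using that assms
    by (simp add: P_block_dim P_block_index f_def block_weight_def sum_distrib_left mult.assoc)
  have on: "sum_mats d (\<lambda>m. complex_of_real (\<gamma> n m) \<cdot>\<^sub>m
        outer_prod (chain_vec bs V n (m - 1)) (chain_vec bs V n (m - 1))) {1..len bs n} $$ (a, b) =
      (\<Sum>k<len bs n. f n k)" if "n \<in> I_mu bs \<mu>" for n
  proof -
    have "sum_mats d (\<lambda>m. complex_of_real (\<gamma> n m) \<cdot>\<^sub>m
        outer_prod (chain_vec bs V n (m - 1)) (chain_vec bs V n (m - 1))) {1..len bs n} $$ (a, b) =
      (\<Sum>m=1..len bs n. f n (m - 1))"
      using assms that by (simp add: sum_mats_def f_def block_weight_def)
    also have "\<dots> = (\<Sum>k<len bs n. f n k)"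
      by (rule sum.reindex_bij_witness[where i = Suc and j = "\<lambda>i. i - 1"]) auto
    finally show ?thesis .
  qed
  have "P0 d bs V \<mu> \<beta> \<gamma> $$ (a, b) =
      (\<Sum>n\<in>{..<length bs} - I_mu bs \<mu>. \<Sum>k<len bs n. f n k) + (\<Sum>n\<in>I_mu bs \<mu>. \<Sum>k<len bs n. f n k)"
    using assms off on
    by (auto simp: P0_def sum_mats_def[of d _ "{..<length bs} - I_mu bs \<mu>"]
        sum_mats_def[of d _ "I_mu bs \<mu>"] intro!: arg_cong2[where f = "(+)"] sum.cong)
  also have "\<dots> = (\<Sum>n<length bs. \<Sum>k<len bs n. f n k)"
    by (rule sum.subset_diff[OF I finite_lessThan, symmetric])
  also have "\<dots> = (\<Sum>(n, k)\<in>(SIGMA n:{..<length bs}. {..<len bs n}). f n k)"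
    by (rule sum.Sigma) auto
  finally show ?thesis by (simp add: f_def)
qed

lemma P0_dim [simp]: "dim_row (P0 d bs V \<mu> \<beta> \<gamma>) = d" "dim_col (P0 d bs V \<mu> \<beta> \<gamma>) = d"
  using P0_carrier by (rule carrier_matD)+

lemma P0_hermitian: "mat_adjoint (P0 d bs V \<mu> \<beta> \<gamma>) = P0 d bs V \<mu> \<beta> \<gamma>"
proof (rule eq_matI)
  fix a b assume "a < dim_row (P0 d bs V \<mu> \<beta> \<gamma>)" "b < dim_col (P0 d bs V \<mu> \<beta> \<gamma>)"
  then have "a < d" "b < d" by simp_all
  then show "mat_adjoint (P0 d bs V \<mu> \<beta> \<gamma>) $$ (a, b) = P0 d bs V \<mu> \<beta> \<gamma> $$ (a, b)"
    by (simp add: P0_index case_prod_beta mult.commute)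
qed simp_all

lemma P0_quadratic_form:
  assumes "x \<in> carrier_vec d"
  shows "(P0 d bs V \<mu> \<beta> \<gamma> *\<^sub>v x) \<bullet>c x =
    of_real (\<Sum>n<length bs. \<Sum>k<len bs n. block_weight bs \<mu> \<beta> \<gamma> n k * (cmod (x \<bullet>c chain_vec bs V n k))\<^sup>2)"
proof -
  have "(P0 d bs V \<mu> \<beta> \<gamma> *\<^sub>v x) \<bullet>c x =
    of_real (\<Sum>s\<in>(SIGMA n:{..<length bs}. {..<len bs n}). block_weight bs \<mu> \<beta> \<gamma> (fst s) (snd s) *
      (cmod (x \<bullet>c chain_vec bs V (fst s) (snd s)))\<^sup>2)"
    by (rule rank_one_sum_quadratic_form[OF P0_carrier assms])
      (simp_all add: P0_index case_prod_beta)
  also have "(\<Sum>s\<in>(SIGMA n:{..<length bs}. {..<len bs n}). block_weight bs \<mu> \<beta> \<gamma> (fst s) (snd s) *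
      (cmod (x \<bullet>c chain_vec bs V (fst s) (snd s)))\<^sup>2) =
    (\<Sum>n<length bs. \<Sum>k<len bs n. block_weight bs \<mu> \<beta> \<gamma> n k * (cmod (x \<bullet>c chain_vec bs V n k))\<^sup>2)"
    by (subst sum.Sigma) (simp_all add: case_prod_beta)
  finally show ?thesis .
qed

end

section \<open>From the differential equation to the chains\<close>

lemma solves_ode_cscalar_prod:
  assumes ode: "solves_ode d C x" and C: "C \<in> carrier_mat d d" and v: "v \<in> carrier_vec d" and t: "t \<ge> 0"
  shows "((\<lambda>s. x s \<bullet>c v) has_vector_derivative - (x t \<bullet>c (mat_adjoint C *\<^sub>v v))) (at t within {0..})"
proof -
  have x: "x t \<in> carrier_vec d"
    and deriv: "\<And>i. i < d \<Longrightarrow> ((\<lambda>s. x s $ i) has_vector_derivative (- (C *\<^sub>v x t)) $ i) (at t within {0..})"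
    using ode t by (auto simp: solves_ode_def)
  have "((\<lambda>s. \<Sum>i<d. x s $ i * cnj (v $ i)) has_vector_derivative
      (\<Sum>i<d. (- (C *\<^sub>v x t)) $ i * cnj (v $ i))) (at t within {0..})"
    by (intro has_vector_derivative_sum has_vector_derivative_mult_left deriv) simp
  also have "(\<Sum>i<d. (- (C *\<^sub>v x t)) $ i * cnj (v $ i)) = - ((C *\<^sub>v x t) \<bullet>c v)"
    using v C unfolding cscalar_prod_sum by (simp add: sum_negf)
  also have "(C *\<^sub>v x t) \<bullet>c v = x t \<bullet>c (mat_adjoint C *\<^sub>v v)"
    by (rule cscalar_prod_adjoint[OF C x v])
  finally show ?thesis using v by (simp add: cscalar_prod_sum)
qed

lemma jordan_nf_spectrum:
  fixes A :: "complex mat"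
  assumes A: "A \<in> carrier_mat d d" and nf: "jordan_nf A bs" and z: "z \<in> spectrum A"
  shows "z \<in> snd ` set bs"
proof -
  have "poly (char_poly A) z = 0" using z by (simp add: spectrum_root_char_poly[OF A])
  then have "prod_list (map (\<lambda>b. (z - snd b) ^ fst b) bs) = 0"
    unfolding jordan_nf_char_poly[OF nf] poly_prod_list map_map
    by (simp add: o_def case_prod_beta poly_power)
  then show ?thesis by (force simp: prod_list_zero_iff)
qed

text \<open>\<open>max_block_size\<close> ranges over all Jordan normal forms of \<open>C\<close>.
  By uniqueness they have the same set of blocks, so the maximum can be read off the given
  list.\<close>

lemma adjoint_jordan_decomp:
  assumes C: "C \<in> carrier_mat d d" and decomp: "jordan_decomp (mat_adjoint C) bs V"
  shows ev_in_spectrum: "n < length bs \<Longrightarrow> ev bs n \<in> spectrum C"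
    and spectrum_eq_ev: "z \<in> spectrum C \<Longrightarrow> \<exists>n<length bs. ev bs n = z"
    and max_block_size_eq:
      "max_block_size C \<mu> = Max {len bs n | n. n < length bs \<and> Re (ev bs n) = \<mu>}"
proof -
  define bs' where "bs' = map (\<lambda>(l, z). (l, cnj z)) bs"
  have nf: "jordan_nf C bs'"
    unfolding bs'_def using decomp jordan_nf_iff_jordan_decomp by (blast intro: jordan_nf_adjoint)
  have nth: "length bs' = length bs" "n < length bs \<Longrightarrow> bs' ! n = (len bs n, ev bs n)" for n
    by (simp_all add: bs'_def len_def ev_def case_prod_beta)
  have mem: "(l, z) \<in> set bs' \<longleftrightarrow> (\<exists>n<length bs. l = len bs n \<and> z = ev bs n)" for l z
    using nth by (auto simp: in_set_conv_nth)
  obtain V' where "jordan_decomp C bs' V'"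
    using nf jordan_nf_iff_jordan_decomp by blast
  then interpret C: jordan_decomposition d C V' bs'
    using C by unfold_locales
  show "ev bs n \<in> spectrum C" if "n < length bs"
    using C.eigenvalue_in_spectrum[of n] nth that by simp
  show "\<exists>n<length bs. ev bs n = z" if "z \<in> spectrum C"
    using jordan_nf_spectrum[OF C nf that] mem by auto
  have "{l. \<exists>bs z. jordan_nf C bs \<and> (l, z) \<in> set bs \<and> Re z = \<mu>} = {l. \<exists>z. (l, z) \<in> set bs' \<and> Re z = \<mu>}"
    using nf jordan_nf_unique[OF nf] by blast
  also have "\<dots> = {len bs n | n. n < length bs \<and> Re (ev bs n) = \<mu>}"
    unfolding mem by blast
  finally show "max_block_size C \<mu> = Max {len bs n | n. n < length bs \<and> Re (ev bs n) = \<mu>}"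
    by (simp add: max_block_size_def)
qed

locale decay_setting = jordan_decomposition d "mat_adjoint C" V bs for d C V bs +
  fixes \<mu> :: real and M :: nat and \<beta> :: "nat \<Rightarrow> real" and \<gamma> :: "nat \<Rightarrow> nat \<Rightarrow> real"
  assumes d: "d \<ge> 1" and C: "C \<in> carrier_mat d d"
    and \<mu>: "\<mu> = min_Re_ev C" and M: "M = max_block_size C \<mu>"
    and \<beta>: "\<And>n. n < length bs \<Longrightarrow> n \<notin> I_mu bs \<mu> \<Longrightarrow> \<beta> n > 0"
    and \<gamma>: "\<And>n m. n \<in> I_mu bs \<mu> \<Longrightarrow> 1 \<le> m \<Longrightarrow> m \<le> len bs n \<Longrightarrow> \<gamma> n m > 0"
begin

abbreviation weight_ratio :: "nat \<Rightarrow> real" where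
  "weight_ratio n \<equiv> \<Sum>m=1..len bs n. \<gamma> n m / Min (\<gamma> n ` {1..m})"

abbreviation quad :: "complex vec \<Rightarrow> real" where
  "quad x \<equiv> \<Sum>n<length bs. \<Sum>k<len bs n. block_weight bs \<mu> \<beta> \<gamma> n k * (cmod (x \<bullet>c chain_vec bs V n k))\<^sup>2"

text \<open>What remains of \<open>decay_const\<close> without the quotient of extremal eigenvalues
  of \<open>P0\<close>: the price of the decay of \<open>quad\<close> itself.\<close>

definition growth :: real where
  "growth = (if M = 1 then 1 else 2 * c_const M * Max (weight_ratio ` I_mu bs \<mu>))"

lemma Re_ev_ge: "n < length bs \<Longrightarrow> Re (ev bs n) \<ge> \<mu>"
  unfolding \<mu> min_Re_ev_def
  using ev_in_spectrum[OF C decomp] card_finite_spectrum(1)[OF C] by (intro Min_le) auto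

text \<open>Attainment uses \<open>d \<ge> 1\<close>: the spectrum is nonempty, so \<mu> is the real
  part of an eigenvalue and some block belongs to it.\<close>

lemma max_len:
  shows len_le_M: "n < length bs \<Longrightarrow> Re (ev bs n) = \<mu> \<Longrightarrow> len bs n \<le> M"
    and exists_len_eq_M: "\<exists>n<length bs. Re (ev bs n) = \<mu> \<and> len bs n = M"
proof -
  let ?L = "{len bs n | n. n < length bs \<and> Re (ev bs n) = \<mu>}"
  have fin: "finite ?L" by simp
  have M_eq: "M = Max ?L" unfolding M by (rule max_block_size_eq[OF C decomp])
  show "len bs n \<le> M" if "n < length bs" "Re (ev bs n) = \<mu>"
    unfolding M_eq by (rule Max_ge[OF fin]) (use that in blast)
  have "\<mu> \<in> Re ` spectrum C"
    unfolding \<mu> min_Re_ev_def using card_finite_spectrum(1)[OF C] spectrum_non_empty[OF C] d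
    by (intro Min_in) auto
  then have "?L \<noteq> {}" using spectrum_eq_ev[OF C decomp] by blast
  then have "M \<in> ?L" unfolding M_eq by (intro Max_in fin)
  then show "\<exists>n<length bs. Re (ev bs n) = \<mu> \<and> len bs n = M" by auto
qed

lemma M_pos: "M \<ge> 1"
  using exists_len_eq_M len_pos by force

lemma finite_I_mu: "finite (I_mu bs \<mu>)"
  by (rule finite_subset[of _ "{..<length bs}"]) (auto simp: I_mu_def)

lemma I_mu_D: "n \<in> I_mu bs \<mu> \<Longrightarrow> n < length bs \<and> 1 < len bs n \<and> Re (ev bs n) = \<mu>"
  by (simp add: I_mu_def)

lemma weight_ratio_ge_1: "n \<in> I_mu bs \<mu> \<Longrightarrow> weight_ratio n \<ge> 1"
  using \<gamma> I_mu_D[of n] by (intro sum_ratio_running_Min_ge_1) auto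

text \<open>For \<open>M \<noteq> 1\<close> a block attaining \<open>M\<close> lies in
  \<open>I_mu\<close>, so the maximum is over a nonempty set.\<close>

lemma Max_weight_ratio_ge_1:
  assumes "M \<noteq> 1"
  shows "Max (weight_ratio ` I_mu bs \<mu>) \<ge> 1"
proof -
  obtain n where n: "n \<in> I_mu bs \<mu>"
    using exists_len_eq_M M_pos assms by (fastforce simp: I_mu_def)
  have "weight_ratio n \<le> Max (weight_ratio ` I_mu bs \<mu>)"
    using n finite_I_mu by (intro Max_ge) auto
  with weight_ratio_ge_1[OF n] show ?thesis by (rule order_trans)
qed

text \<open>Lets blocks outside \<open>I_mu\<close>, which decay with constant 1, share the common
  bound.\<close>

lemma growth_ge_1: "growth \<ge> 1"
proof (cases "M = 1")
  case False
  then have "1 * 1 \<le> (2 * c_const M) * Max (weight_ratio ` I_mu bs \<mu>)"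
    using Max_weight_ratio_ge_1 sum_inverse_fact_squares_le_c_const(2)[of M] M_pos
    by (intro mult_mono) auto
  then show ?thesis using False by (simp add: growth_def)
qed (unfold growth_def, simp)

lemma block_weight_pos:
  assumes "n < length bs" "k < len bs n"
  shows "block_weight bs \<mu> \<beta> \<gamma> n k > 0"
proof (cases "n \<in> I_mu bs \<mu>")
  case True
  then show ?thesis using \<gamma>[OF True, of "Suc k"] assms by (simp add: block_weight_def)
next
  case False
  \<comment> \<open>At length 1 the coefficient is 1; a longer block outside \<open>I_mu\<close> has
    real part above \<mu>, so the base of the power is positive.\<close>
  have "b_coeff bs \<mu> n (len bs n - k) > 0"
  proof (cases "len bs n = 1")
    case True
    then show ?thesis using assms by simp
  next
    case len: False
    then have "Re (ev bs n) > \<mu>"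
      using False Re_ev_ge[OF assms(1)] assms by (auto simp: I_mu_def)
    then show ?thesis using assms by (auto simp: b_coeff_def intro!: mult_pos_pos kappa_pos)
  qed
  then show ?thesis using False \<beta>[OF assms(1)] by (simp add: block_weight_def)
qed

lemma P0_pos_def: "hermitian_pos_def (P0 d bs V \<mu> \<beta> \<gamma>)"
  unfolding hermitian_pos_def_def P0_dim
proof (intro conjI ballI impI P0_hermitian)
  fix x :: "complex vec" assume x: "x \<in> carrier_vec d" "x \<noteq> 0\<^sub>v d"
  obtain n k where nk: "n < length bs" "k < len bs n" "x \<bullet>c chain_vec bs V n k \<noteq> 0"
    using exists_chain_vec_not_orthogonal[OF x] by blast
  have nonneg: "block_weight bs \<mu> \<beta> \<gamma> i j * (cmod (x \<bullet>c chain_vec bs V i j))\<^sup>2 \<ge> 0"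
    if "i < length bs" "j < len bs i" for i j
    using block_weight_pos[OF that] by simp
  have "0 < block_weight bs \<mu> \<beta> \<gamma> n k * (cmod (x \<bullet>c chain_vec bs V n k))\<^sup>2"
    using nk block_weight_pos by simp
  also have "\<dots> \<le> (\<Sum>k<len bs n. block_weight bs \<mu> \<beta> \<gamma> n k * (cmod (x \<bullet>c chain_vec bs V n k))\<^sup>2)"
    by (rule member_le_sum) (use nk nonneg in auto)
  also have "\<dots> \<le> quad x"
    by (rule member_le_sum[where f = "\<lambda>n. \<Sum>k<len bs n. block_weight bs \<mu> \<beta> \<gamma> n k * (cmod (x \<bullet>c chain_vec bs V n k))\<^sup>2"])
      (use nk nonneg in \<open>auto intro!: sum_nonneg\<close>)
  finally show "Re ((P0 d bs V \<mu> \<beta> \<gamma> *\<^sub>v x) \<bullet>c x) > 0"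
    unfolding P0_quadratic_form[OF x(1)] Re_complex_of_real .
qed

text \<open>The product conjugates its second argument, so the adjoint's eigenvalue reappears as the
  eigenvalue \<open>ev bs n\<close> of \<open>C\<close>.\<close>

lemma chain_coordinate_deriv:
  assumes "solves_ode d C x" "n < length bs" "k < len bs n" "t \<ge> 0"
  shows "((\<lambda>s. x s \<bullet>c chain_vec bs V n k) has_vector_derivative
    - ev bs n * (x t \<bullet>c chain_vec bs V n k) -
    (if k = 0 then 0 else x t \<bullet>c chain_vec bs V n (k - 1))) (at t within {0..})"
proof -
  have x: "x t \<in> carrier_vec d" using assms by (simp add: solves_ode_def)
  have "x t \<bullet>c (mat_adjoint C *\<^sub>v chain_vec bs V n k) =
      ev bs n * (x t \<bullet>c chain_vec bs V n k) + (if k = 0 then 0 else x t \<bullet>c chain_vec bs V n (k - 1))"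
    unfolding mult_chain_vec[OF assms(2,3)] using x
    by (auto simp: cscalar_prod_sum ev_def algebra_simps sum.distrib sum_distrib_left)
  then show ?thesis
    using solves_ode_cscalar_prod[OF assms(1) C chain_vec_carrier assms(4), of n k]
    by (simp only: minus_add_distrib minus_mult_left diff_conv_add_uminus)
qed

text \<open>The factor is the same for all blocks, so that summation over \<open>n\<close> needs no
  further estimate. Critical, one-dimensional and damped blocks are treated separately.\<close>

lemma block_decay:
  assumes ode: "solves_ode d C x" and n: "n < length bs" and t: "t \<ge> 0"
  shows "(\<Sum>k<len bs n. block_weight bs \<mu> \<beta> \<gamma> n k * (cmod (x t \<bullet>c chain_vec bs V n k))\<^sup>2) \<le>
    growth * (1 + t ^ (2 * (M - 1))) * exp (- 2 * \<mu> * t) *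
    (\<Sum>k<len bs n. block_weight bs \<mu> \<beta> \<gamma> n k * (cmod (x 0 \<bullet>c chain_vec bs V n k))\<^sup>2)"
proof -
  define y where "y = (\<lambda>k t. x t \<bullet>c chain_vec bs V n k)"
  define w where "w = block_weight bs \<mu> \<beta> \<gamma> n"
  define T where "T = 1 + t ^ (2 * (M - 1))"
  have T: "T \<ge> 1" using t by (simp add: T_def)
  have deriv: "(y k has_vector_derivative - ev bs n * y k t - (if k = 0 then 0 else y (k - 1) t))
      (at t within {0..})" if "k < len bs n" "t \<ge> 0" for k t
    unfolding y_def by (rule chain_coordinate_deriv[OF ode n that])
  have w_pos: "w k > 0" if "k < len bs n" for k
    unfolding w_def by (rule block_weight_pos[OF n that])
  define Q0 where "Q0 = (\<Sum>k<len bs n. w k * (cmod (y k 0))\<^sup>2)"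
  have Q0: "Q0 \<ge> 0" unfolding Q0_def using w_pos by (intro sum_nonneg mult_nonneg_nonneg) (auto intro: less_imp_le)
  have "(\<Sum>k<len bs n. w k * (cmod (y k t))\<^sup>2) \<le> growth * T * exp (- 2 * \<mu> * t) * Q0"
  proof (cases "n \<in> I_mu bs \<mu>")
    case True
    note I = I_mu_D[OF True]
    have "len bs n \<le> M" using len_le_M[OF n] I by simp
    then have "M \<ge> 2" using I by simp
    have shift: "(\<Sum>k<len bs n. w k * (cmod (y k t))\<^sup>2) = (\<Sum>m=1..len bs n. \<gamma> n m * (cmod (y (m - 1) t))\<^sup>2)" for t
      using True by (intro sum.reindex_bij_witness[where j = Suc and i = "\<lambda>i. i - 1"])
        (auto simp: w_def block_weight_def)
    let ?F = "\<Sum>i<M. 1 / (fact i)\<^sup>2 :: real"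
    have "weight_ratio n * ?F \<le> Max (weight_ratio ` I_mu bs \<mu>) * (2 * c_const M)"
    proof (rule mult_mono)
      show "weight_ratio n \<le> Max (weight_ratio ` I_mu bs \<mu>)"
        using True finite_I_mu by (intro Max_ge) auto
      show "?F \<le> 2 * c_const M"
        using sum_inverse_fact_squares_le_c_const[OF \<open>M \<ge> 2\<close>] by linarith
      show "0 \<le> Max (weight_ratio ` I_mu bs \<mu>)"
        using Max_weight_ratio_ge_1 \<open>M \<ge> 2\<close> by linarith
    qed (simp add: sum_nonneg)
    also have "\<dots> = growth" using \<open>M \<ge> 2\<close> by (simp add: growth_def)
    finally have coeff: "weight_ratio n * ?F \<le> growth" .
    have "(\<Sum>m=1..len bs n. \<gamma> n m * (cmod (y (m - 1) t))\<^sup>2) \<le>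
        weight_ratio n * ?F * T * exp (- 2 * Re (ev bs n) * t) *
        (\<Sum>m=1..len bs n. \<gamma> n m * (cmod (y (m - 1) 0))\<^sup>2)"
      unfolding T_def
      by (rule jordan_chain_critical_bound[OF deriv \<gamma>[OF True] \<open>len bs n \<le> M\<close> t])
    then have "(\<Sum>k<len bs n. w k * (cmod (y k t))\<^sup>2) \<le> weight_ratio n * ?F * (T * exp (- 2 * \<mu> * t) * Q0)"
      using I by (simp only: shift Q0_def mult.assoc)
    also have "\<dots> \<le> growth * (T * exp (- 2 * \<mu> * t) * Q0)"
      using coeff T Q0 by (intro mult_right_mono) auto
    finally show ?thesis by (simp only: mult.assoc)
  next
    case False
    have "(\<Sum>k<len bs n. w k * (cmod (y k t))\<^sup>2) \<le> exp (- 2 * \<mu> * t) * Q0"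
    \<comment> \<open>A block of length 1 may have real part equal to \<mu>, where the damped
      estimate does not apply; its single coordinate is a pure exponential.\<close>
    proof (cases "len bs n = 1")
      case True
      have "cmod (exp (ev bs n * of_real t) * y 0 t) = cmod (y 0 0)"
        using jordan_chain_solution[of "len bs n" y "ev bs n" 0 t, OF deriv] True t by simp
      then have "exp (Re (ev bs n) * t) * cmod (y 0 t) = cmod (y 0 0)"
        by (simp add: norm_mult)
      then have *: "cmod (y 0 t) = exp (- Re (ev bs n) * t) * cmod (y 0 0)"
        by (simp add: exp_minus field_simps)
      have "exp (- Re (ev bs n) * t) \<le> exp (- \<mu> * t)"
        using Re_ev_ge[OF n] t by (simp add: mult_right_mono)
      then have "cmod (y 0 t) \<le> exp (- \<mu> * t) * cmod (y 0 0)"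
        unfolding * by (rule mult_right_mono) simp
      then have "(cmod (y 0 t))\<^sup>2 \<le> (exp (- \<mu> * t) * cmod (y 0 0))\<^sup>2"
        by (rule power_mono) simp
      also have "\<dots> = exp (- 2 * \<mu> * t) * (cmod (y 0 0))\<^sup>2"
        by (simp add: power_mult_distrib exp_double[symmetric] mult.assoc)
      finally have "w 0 * (cmod (y 0 t))\<^sup>2 \<le> w 0 * (exp (- 2 * \<mu> * t) * (cmod (y 0 0))\<^sup>2)"
        using w_pos[of 0] True by (intro mult_left_mono) auto
      then show ?thesis using True by (simp add: Q0_def mult_ac)
    next
      case len: False
      then have "Re (ev bs n) > \<mu>"
        using False Re_ev_ge[OF n] n len_pos[OF n] by (auto simp: I_mu_def)
      have w_eq: "w k = \<beta> n * b_coeff bs \<mu> n (len bs n - k)" for k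
        using False by (simp add: w_def block_weight_def)
      have "(\<Sum>k<len bs n. b_coeff bs \<mu> n (len bs n - k) * (cmod (y k t))\<^sup>2) \<le> exp (- 2 * \<mu> * t) *
          (\<Sum>k<len bs n. b_coeff bs \<mu> n (len bs n - k) * (cmod (y k 0))\<^sup>2)"
        by (rule jordan_chain_damped_bound[OF deriv \<open>Re (ev bs n) > \<mu>\<close> b_coeff_def t])
      then have "\<beta> n * (\<Sum>k<len bs n. b_coeff bs \<mu> n (len bs n - k) * (cmod (y k t))\<^sup>2) \<le> \<beta> n * (exp (- 2 * \<mu> * t) *
          (\<Sum>k<len bs n. b_coeff bs \<mu> n (len bs n - k) * (cmod (y k 0))\<^sup>2))"
        using \<beta>[OF n False] by (intro mult_left_mono) auto
      then show ?thesis
        unfolding Q0_def w_eq by (simp only: sum_distrib_left mult_ac)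
    qed
    also have "\<dots> = 1 * 1 * (exp (- 2 * \<mu> * t) * Q0)" by simp
    also have "\<dots> \<le> growth * T * (exp (- 2 * \<mu> * t) * Q0)"
      using growth_ge_1 T Q0 by (intro mult_right_mono mult_mono) auto
    finally show ?thesis by (simp only: mult.assoc)
  qed
  then show ?thesis by (simp only: y_def w_def T_def Q0_def)
qed

lemma quad_decay:
  assumes "solves_ode d C x" "t \<ge> 0"
  shows "quad (x t) \<le> growth * (1 + t ^ (2 * (M - 1))) * exp (- 2 * \<mu> * t) * quad (x 0)"
proof -
  have "quad (x t) \<le> (\<Sum>n<length bs. growth * (1 + t ^ (2 * (M - 1))) * exp (- 2 * \<mu> * t) *
      (\<Sum>k<len bs n. block_weight bs \<mu> \<beta> \<gamma> n k * (cmod (x 0 \<bullet>c chain_vec bs V n k))\<^sup>2))"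
    by (rule sum_mono) (rule block_decay[OF assms(1) _ assms(2)], simp)
  also have "\<dots> = growth * (1 + t ^ (2 * (M - 1))) * exp (- 2 * \<mu> * t) * quad (x 0)"
    by (rule sum_distrib_left[symmetric])
  finally show ?thesis .
qed

lemma decay_bound_P0:
  "decay_const d bs V \<mu> M \<beta> \<gamma> > 0" "decay_bound d C \<mu> M (decay_const d bs V \<mu> M \<beta> \<gamma>)"
proof -
  let ?P = "P0 d bs V \<mu> \<beta> \<gamma>"
  define lmin where "lmin = min_Re_ev ?P"
  define lmax where "lmax = max_Re_ev ?P"
  have fin: "finite (spectrum ?P)" "spectrum ?P \<noteq> {}"
    using card_finite_spectrum(1)[OF P0_carrier] spectrum_non_empty[OF P0_carrier] d by auto
  obtain z where z: "z \<in> spectrum ?P" using fin(2) by blast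
  have "lmin > 0"
    unfolding lmin_def min_Re_ev_def
    using fin hermitian_pos_def_spectrum[OF P0_carrier P0_pos_def] by (subst Min_gr_iff) auto
  moreover have "lmin \<le> Re z" "Re z \<le> lmax"
    unfolding lmin_def lmax_def min_Re_ev_def max_Re_ev_def
    using fin z by (auto intro!: Min_le Max_ge)
  ultimately have "lmax > 0" by simp
  \<comment> \<open>The case distinction on \<open>M\<close> is absorbed by \<open>growth\<close>;
    the other two factors come from the two Rayleigh bounds.\<close>
  have K: "decay_const d bs V \<mu> M \<beta> \<gamma> = inverse lmin * lmax * growth"
    by (simp add: decay_const_def lmin_def lmax_def growth_def Let_def)
  show "decay_const d bs V \<mu> M \<beta> \<gamma> > 0"
    unfolding K using \<open>lmin > 0\<close> \<open>lmax > 0\<close> growth_ge_1 by simp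
  show "decay_bound d C \<mu> M (decay_const d bs V \<mu> M \<beta> \<gamma>)"
    unfolding decay_bound_def
  proof (intro allI impI)
    fix x and t :: real assume x: "solves_ode d C x" and t: "t \<ge> 0"
    have carrier: "x t \<in> carrier_vec d" "x 0 \<in> carrier_vec d"
      using x t by (simp_all add: solves_ode_def)
    have lower: "lmin * (eucl_norm (x t))\<^sup>2 \<le> quad (x t)"
      using hermitian_Rayleigh_bounds(1)[OF P0_carrier P0_hermitian carrier(1), of \<mu> \<beta> \<gamma>]
      unfolding P0_quadratic_form[OF carrier(1)] Re_complex_of_real lmin_def .
    have upper: "quad (x 0) \<le> lmax * (eucl_norm (x 0))\<^sup>2"
      using hermitian_Rayleigh_bounds(2)[OF P0_carrier P0_hermitian carrier(2), of \<mu> \<beta> \<gamma>]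
      unfolding P0_quadratic_form[OF carrier(2)] Re_complex_of_real lmax_def .
    define G where "G = growth * (1 + t ^ (2 * (M - 1))) * exp (- 2 * \<mu> * t)"
    have "G \<ge> 0" using growth_ge_1 t by (simp add: G_def)
    have "lmin * (eucl_norm (x t))\<^sup>2 \<le> G * quad (x 0)"
      using lower quad_decay[OF x t] unfolding G_def by (rule order_trans)
    also have "\<dots> \<le> G * (lmax * (eucl_norm (x 0))\<^sup>2)"
      using upper \<open>G \<ge> 0\<close> by (rule mult_left_mono)
    finally have "(eucl_norm (x t))\<^sup>2 \<le> inverse lmin * (G * (lmax * (eucl_norm (x 0))\<^sup>2))"
      using \<open>lmin > 0\<close> by (simp add: field_simps)
    then show "(eucl_norm (x t))\<^sup>2 \<le> decay_const d bs V \<mu> M \<beta> \<gamma> * (1 + t ^ (2 * (M - 1))) *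
        exp (- 2 * \<mu> * t) * (eucl_norm (x 0))\<^sup>2"
      unfolding K G_def by (simp only: mult_ac)
  qed
qed

end

theorem theorem2p8:
  fixes C :: "complex mat" and d M :: nat and \<mu> :: real
  assumes "d \<ge> 1" and "C \<in> carrier_mat d d"
    and "positive_stable C"
    and "\<mu> = min_Re_ev C"
    and "M = max_block_size C \<mu>"
  shows "(\<exists>K>0. decay_bound d C \<mu> M K) \<and>
    (\<forall>bs V \<beta> \<gamma>.
       jordan_decomp (mat_adjoint C) bs V \<and>
       (\<forall>n\<in>{..<length bs} - I_mu bs \<mu>. \<beta> n > 0) \<and>
       (\<forall>n\<in>I_mu bs \<mu>. \<forall>m\<in>{1..len bs n}. \<gamma> n m > 0) \<longrightarrow>
       hermitian_pos_def (P0 d bs V \<mu> \<beta> \<gamma>) \<and>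
       decay_const d bs V \<mu> M \<beta> \<gamma> > 0 \<and>
       decay_bound d C \<mu> M (decay_const d bs V \<mu> M \<beta> \<gamma>))"
proof -
  have adj: "mat_adjoint C \<in> carrier_mat d d" using assms(2) by simp
  have main: "hermitian_pos_def (P0 d bs V \<mu> \<beta> \<gamma>) \<and> decay_const d bs V \<mu> M \<beta> \<gamma> > 0 \<and>
      decay_bound d C \<mu> M (decay_const d bs V \<mu> M \<beta> \<gamma>)"
    if "jordan_decomp (mat_adjoint C) bs V" "\<forall>n\<in>{..<length bs} - I_mu bs \<mu>. \<beta> n > 0"
      "\<forall>n\<in>I_mu bs \<mu>. \<forall>m\<in>{1..len bs n}. \<gamma> n m > 0" for bs V \<beta> \<gamma>
  proof -
    interpret decay_setting d C V bs \<mu> M \<beta> \<gamma>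
      using adj assms that by unfold_locales auto
    show ?thesis using P0_pos_def decay_bound_P0 by blast
  qed
  \<comment> \<open>For the bare existence of a constant some decomposition is needed: it exists
    because the characteristic polynomial splits over the complex numbers, and all weights are set
    to 1.\<close>
  obtain as where "char_poly (mat_adjoint C) = (\<Prod>a\<leftarrow>as. [:- a, 1:])"
    using char_poly_factorized[OF adj] by blast
  then obtain bs V where "jordan_decomp (mat_adjoint C) bs V"
    using jordan_nf_exists[OF adj] jordan_nf_iff_jordan_decomp by metis
  from main[OF this, of "\<lambda>_. 1" "\<lambda>_ _. 1"] have "\<exists>K>0. decay_bound d C \<mu> M K" by auto
  with main show ?thesis by blast
qed

end
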